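(* Consider the network with a MAC-coordinator with $M\ge1$ stations, transmission probability $p\in(0,1)$, red arrival rate $\lambda_R$ and green arrival rate $\lambda_G$, as defined in the context. Assume $\lambda_R<1$. Then the system is stable if $$\begin{cases}\lambda_G<(1-\lambda_R)\,p, & \text{if } M=1,\\[2pt] \lambda_G<\lambda_R(M-1)p(1-p)^{M-2}+(1-\lambda_R)Mp(1-p)^{M-1}, & \text{if } M>1,\end{cases}$$ and it is unstable if the opposite strict inequality holds (i.e. if $<$ is replaced by $>$ in the corresponding line).
   Context: The network with a MAC-coordinator. There are $M$ stations numbered $1,\dots,M$, each with two infinite buffers, one for "red" and one for "green" messages. Time is slotted. $R^t_i$ and $G^t_i$ are the numbers of red and green messages in the buffers of station $i$ at the beginning of slot $t$. Let $i(t)=((t-1)\bmod M)+1$. Arrivals: the total numbers $\xi^t$ of new red messages in successive slots are i.i.d. non-negative integer-valued with finite mean $\lambda_R=\mathbf E\xi^t$; the total numbers $\eta^t$ of new green messages are i.i.d. non-negative integer-valued with finite mean $\lambda_G=\mathbf E\eta^t$, independent of the red arrivals. Each arriving message is independently assigned to one of the stations with equal probabilities $1/M$; $\xi^t_i$ and $\eta^t_i$ denote the numbers of red and green messages assigned to station $i$ in slot $t$, so $\sum_i\xi^t_i=\xi^t$ and $\sum_i\eta^t_i=\eta^t$. Red transmissions: in slot $t$, station $i(t)$ successfully transmits one red message if its red buffer is non-empty; no other station transmits red messages. Green transmissions: in slot $t$, every station that is not transmitting a red message and whose green buffer is non-empty attempts to transmit one green message with probability $p$, independently of everything else. If exactly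 one station attempts, the transmission is successful and the message leaves; if two or more attempt, all fail and the messages stay in their buffers. Thus, with i.i.d. Bernoulli($p$) variables $\alpha^t_j$ (independent of the arrivals) and $\gamma^t_j=\alpha^t_j\mathbf I\{G^t_j>0\}$: $R^{t+1}_i=R^t_i+\xi^t_i-\mathbf I\{i=i(t),R^t_i>0\}$; for $i\ne i(t)$, $$G^{t+1}_i=G^t_i+\eta^t_i-\gamma^t_i\prod_{j\ne i,\,j\ne i(t)}(1-\gamma^t_j)\,\bigl(1-\gamma^t_{i(t)}\mathbf I\{R^t_{i(t)}=0\}\bigr),$$ and for $i=i(t)$, $$G^{t+1}_i=G^t_i+\eta^t_i-\mathbf I\{R^t_i=0\}\gamma^t_i\prod_{j\ne i}(1-\gamma^t_j).$$ The system is called stable if its underlying Markov chain $(R^t_1,\dots,R^t_M,G^t_1,\dots,G^t_M)$ (whose transition law at time $t$ depends on $t$ only through $i(t)$) is positive recurrent: there is a finite set $D\subset\mathbb Z_+^{2M}$ such that, for every initial state and every initial value of $i(\cdot)$, the first return time to $D$ (at a time $\ge1$ step later) is a.s. finite, and the expected return time is bounded uniformly over initial states in $D$ and initial values of $i(\cdot)$. It is unstable if it is not stable. *)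

theory Defs
  imports "HOL-Probability.Probability"
begin

text \<open>A state gives the red and the green queue lengths of the stations \<open>1..M\<close>. Indices outside
  \<open>{1..M}\<close> carry the value \<open>0\<close>, so that the set of states is a copy of the \<open>2 * M\<close>-tuples of
  natural numbers.\<close>

type_synonym mac_state = "(nat \<Rightarrow> nat) \<times> (nat \<Rightarrow> nat)"

definition mac_states :: "nat \<Rightarrow> mac_state set" where
  "mac_states M = {(R, G). \<forall>i. i \<notin> {1..M} \<longrightarrow> R i = 0 \<and> G i = 0}"

text \<open>The randomness of one slot: red arrivals \<open>\<xi> i\<close>, green arrivals \<open>\<eta> i\<close> and
  Bernoulli variables \<open>\<alpha> i\<close> of the stations.\<close>

type_synonym mac_input = "(nat \<Rightarrow> nat) \<times> (nat \<Rightarrow> nat) \<times> (nat \<Rightarrow> bool)"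

text \<open>The arguments \<open>red\<close> and \<open>green\<close> are the laws of the total numbers of messages that arrive
  in a slot; the list of stations to which these messages are assigned consists of independent
  uniform choices.\<close>

definition mac_input_pmf :: "nat \<Rightarrow> real \<Rightarrow> nat pmf \<Rightarrow> nat pmf \<Rightarrow> mac_input pmf" where
  "mac_input_pmf M p red green = do {
     m \<leftarrow> red;
     n \<leftarrow> green;
     red_dest \<leftarrow> replicate_pmf m (pmf_of_set {1..M});
     green_dest \<leftarrow> replicate_pmf n (pmf_of_set {1..M});
     \<alpha> \<leftarrow> Pi_pmf {1..M} False (\<lambda>_. bernoulli_pmf p);
     return_pmf (count_list red_dest, count_list green_dest, \<alpha>)
   }"

text \<open>Inputs of successive slots are i.i.d.\<close>

definition mac_space :: "nat \<Rightarrow> real \<Rightarrow> nat pmf \<Rightarrow> nat pmf \<Rightarrow> mac_input stream measure" where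
  "mac_space M p red green = stream_space (measure_pmf (mac_input_pmf M p red green))"

definition coordinator :: "nat \<Rightarrow> nat \<Rightarrow> nat" where
  "coordinator M t = (t - 1) mod M + 1"

definition attempt :: "(nat \<Rightarrow> bool) \<Rightarrow> (nat \<Rightarrow> nat) \<Rightarrow> nat \<Rightarrow> nat" where
  "attempt \<alpha> G j = of_bool (\<alpha> j \<and> G j > 0)"

definition red_departure :: "nat \<Rightarrow> (nat \<Rightarrow> nat) \<Rightarrow> nat \<Rightarrow> nat" where
  "red_departure c R i = of_bool (i = c \<and> R i > 0)"

definition green_departure ::
  "nat \<Rightarrow> nat \<Rightarrow> (nat \<Rightarrow> nat) \<Rightarrow> (nat \<Rightarrow> nat) \<Rightarrow> nat \<Rightarrow> nat" where
  "green_departure M c R \<gamma> i =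
     (if i = c
      then of_bool (R i = 0) * \<gamma> i * (\<Prod>j\<in>{1..M} - {i}. 1 - \<gamma> j)
      else \<gamma> i * (\<Prod>j\<in>{1..M} - {i, c}. 1 - \<gamma> j) * (1 - \<gamma> c * of_bool (R c = 0)))"

text \<open>One slot in which station \<open>c\<close> is the one allowed to transmit red messages. The truncated
  subtractions here and above are exact: \<open>\<gamma> j\<close> is \<open>0\<close> or \<open>1\<close>, and a message departs only from a
  non-empty buffer.\<close>

fun mac_step :: "nat \<Rightarrow> nat \<Rightarrow> mac_input \<Rightarrow> mac_state \<Rightarrow> mac_state" where
  "mac_step M c (\<xi>, \<eta>, \<alpha>) (R, G) =
     (\<lambda>i. R i + \<xi> i - red_departure c R i,
      \<lambda>i. G i + \<eta> i - green_departure M c R (attempt \<alpha> G) i)"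

text \<open>The state after \<open>n\<close> slots, when the first slot is slot number \<open>s\<close>.\<close>

primrec mac_chain ::
  "nat \<Rightarrow> nat \<Rightarrow> mac_state \<Rightarrow> mac_input stream \<Rightarrow> nat \<Rightarrow> mac_state" where
  "mac_chain M s x \<omega> 0 = x"
| "mac_chain M s x \<omega> (Suc n) =
     mac_step M (coordinator M (s + n)) (\<omega> !! n) (mac_chain M s x \<omega> n)"

text \<open>Equal to \<open>\<infinity>\<close>, the infimum of the empty set, if there is no return.\<close>

definition return_time ::
  "nat \<Rightarrow> nat \<Rightarrow> mac_state set \<Rightarrow> mac_state \<Rightarrow> mac_input stream \<Rightarrow> enat" where
  "return_time M s D x \<omega> = Inf {enat n |n. n \<ge> 1 \<and> mac_chain M s x \<omega> n \<in> D}"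

text \<open>Letting the number \<open>s\<close> of the first slot range over \<open>{1..M}\<close> yields each possible initial value
  of the coordinator index exactly once.\<close>

definition mac_stable :: "nat \<Rightarrow> real \<Rightarrow> nat pmf \<Rightarrow> nat pmf \<Rightarrow> bool" where
  "mac_stable M p red green \<longleftrightarrow>
     (\<exists>D. finite D \<and> D \<subseteq> mac_states M \<and>
        (\<forall>x\<in>mac_states M. \<forall>s\<in>{1..M}.
           AE \<omega> in mac_space M p red green. return_time M s D x \<omega> < \<infinity>) \<and>
        (\<exists>C::real. \<forall>x\<in>D. \<forall>s\<in>{1..M}.
           (\<integral>\<^sup>+ \<omega>. ennreal_of_enat (return_time M s D x \<omega>) \<partial>mac_space M p red green) \<le> ennreal C))"

end

theory Submission
  imports Defs
begin

text \<open>Subtracting a suitable linear combination of the red queues from the \<open>i\<close>-th green queue gives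
  a quantity \<open>Z x i\<close> whose one-slot drift is exactly \<open>(green_rate - capacity) / M\<close> while all green
  buffers are non-empty, whichever station is the coordinator; adding to a red queue the time until its
  station is the coordinator makes its drift constant as well. Smoothed positive parts (Huber functions)
  turn these into a Lyapunov function, with second-order errors that vanish for large smoothing width
  because the arrivals are integrable. Below capacity, Foster's criterion gives stability. Above
  capacity, a potential built from the mean of the \<open>Z x i\<close> is a submartingale once truncated below at a
  large level. It vanishes on the finite set and its jumps have bounded expectation, which contradicts
  finite expected return times.\<close>

section \<open>Killed kernels\<close>

text \<open>The service of a green buffer depends on whether the coordinator sends a red message;
  the weights in \<open>Z\<close> are chosen so that each red departure offsets, in the mean, the
  change of green service that it causes. Arrivals have only first moments, so quadratic functions
  of the queues need not be integrable. Huber functions grow linearly, and their error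
  \<open>min b (b\<^sup>2 / L)\<close> is handled by dominated convergence. The main obstacle is
  empty green buffers. They only help the non-empty stations, so below capacity it is enough to
  control the empty ones: there \<open>Z x i\<close> is at most the corrected red queue
  \<open>W c x i\<close>, and a large weight on the red terms pays for the missing service. Above
  capacity, the reduced contention works against the proof. The potential therefore penalises both
  imbalance among the \<open>Z x i\<close> and long red queues, so that a large value excludes empty
  green buffers altogether.\<close>

definition killed :: "'u pmf \<Rightarrow> ('u \<Rightarrow> 'a \<Rightarrow> 'a) \<Rightarrow> 'a set \<Rightarrow> ('a \<Rightarrow> ennreal) \<Rightarrow> 'a \<Rightarrow> ennreal" where
  "killed P F D f a = (\<integral>\<^sup>+ u. (if F u a \<in> D then 0 else f (F u a)) \<partial>measure_pmf P)"

text \<open>The \<open>n\<close>-th term is the probability that the return time to \<open>D\<close>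
  exceeds \<open>n\<close>, so the series is the mean return time. \<open>killed\<close> tests only
  the new state: the start may lie in \<open>D\<close>, as befits a return after at least one
  step.\<close>

definition occupation :: "'u pmf \<Rightarrow> ('u \<Rightarrow> 'a \<Rightarrow> 'a) \<Rightarrow> 'a set \<Rightarrow> 'a \<Rightarrow> ennreal" where
  "occupation P F D a = (\<Sum>n. (killed P F D ^^ n) (\<lambda>_. 1) a)"

lemma killed_suminf: "killed P F D (\<lambda>b. \<Sum>n. f n b) a = (\<Sum>n. killed P F D (f n) a)"
proof -
  have "killed P F D (\<lambda>b. \<Sum>n. f n b) a
      = (\<integral>\<^sup>+ u. (\<Sum>n. if F u a \<in> D then 0 else f n (F u a)) \<partial>measure_pmf P)"
    unfolding killed_def by (intro nn_integral_cong) auto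
  then show ?thesis
    unfolding killed_def by (simp add: nn_integral_suminf)
qed

lemma killed_add: "killed P F D (\<lambda>b. f b + g b) a = killed P F D f a + killed P F D g a"
proof -
  have "killed P F D (\<lambda>b. f b + g b) a = (\<integral>\<^sup>+ u. (if F u a \<in> D then 0 else f (F u a))
      + (if F u a \<in> D then 0 else g (F u a)) \<partial>measure_pmf P)"
    unfolding killed_def by (intro nn_integral_cong) auto
  then show ?thesis
    unfolding killed_def by (simp add: nn_integral_add)
qed

lemma killed_cmult: "killed P F D (\<lambda>b. c * f b) a = c * killed P F D f a"
proof -
  have "killed P F D (\<lambda>b. c * f b) a = (\<integral>\<^sup>+ u. c * (if F u a \<in> D then 0 else f (F u a)) \<partial>measure_pmf P)"
    unfolding killed_def by (intro nn_integral_cong) auto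
  then show ?thesis
    unfolding killed_def by (simp add: nn_integral_cmult)
qed

lemma killed_mono:
  assumes "\<And>u. u \<in> set_pmf P \<Longrightarrow> F u a \<notin> D \<Longrightarrow> f (F u a) \<le> g (F u a)"
  shows "killed P F D f a \<le> killed P F D g a"
  unfolding killed_def using assms by (intro nn_integral_mono_AE) (auto simp: AE_measure_pmf_iff)

text \<open>Monotone convergence moves the kernel inside the series, so \<open>k\<close>
  applications cut off the first \<open>k\<close> terms.\<close>

lemma occupation_shift:
  "(killed P F D ^^ k) (occupation P F D) a = (\<Sum>n. (killed P F D ^^ (n + k)) (\<lambda>_. 1) a)"
proof (induction k arbitrary: a)
  case 0
  then show ?case by (simp add: occupation_def)
next
  case (Suc k)
  have "(killed P F D ^^ Suc k) (occupation P F D) a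
      = killed P F D (\<lambda>b. \<Sum>n. (killed P F D ^^ (n + k)) (\<lambda>_. 1) b) a"
    by (simp add: Suc.IH[abs_def])
  then show ?case
    by (simp add: killed_suminf)
qed

lemma occupation_unfold: "occupation P F D a = 1 + killed P F D (occupation P F D) a"
proof -
  have "occupation P F D a = (\<Sum>n. (killed P F D ^^ Suc n) (\<lambda>_. 1) a) + 1"
    unfolding occupation_def by (subst suminf_offset[where i = 1]) auto
  then show ?thesis
    using occupation_shift[where k = 1 and P = P and F = F and D = D and a = a] by (simp add: add.commute)
qed

text \<open>First-step recursion for the mean of the return time capped at \<open>Suc n\<close>: one
  step is always spent, the rest only on paths that have not hit \<open>D\<close>.\<close>

lemma killed_partial_sum:
  "(\<Sum>k<Suc n. (killed P F D ^^ k) (\<lambda>_. 1) a)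
    = 1 + killed P F D (\<lambda>b. \<Sum>k<n. (killed P F D ^^ k) (\<lambda>_. 1) b) a"
proof (induction n arbitrary: a)
  case 0
  then show ?case by (simp add: killed_def)
next
  case (Suc n)
  have "killed P F D (\<lambda>b. \<Sum>k<Suc n. (killed P F D ^^ k) (\<lambda>_. 1) b) a
      = killed P F D (\<lambda>b. \<Sum>k<n. (killed P F D ^^ k) (\<lambda>_. 1) b) a + (killed P F D ^^ Suc n) (\<lambda>_. 1) a"
    by (simp add: killed_add)
  then show ?case
    using Suc.IH[of a] by (simp add: add.assoc)
qed

text \<open>Induction on the capped return time. Outside \<open>D\<close> each step costs
  \<open>\<delta>\<close> of potential, and killing keeps the induction there, so the surplus
  \<open>b\<close> is paid only once, in the first step, where the start may lie in
  \<open>D\<close>.\<close>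

lemma foster:
  fixes V :: "'a \<Rightarrow> ennreal"
  assumes inv: "\<And>a u. a \<in> S \<Longrightarrow> u \<in> set_pmf P \<Longrightarrow> F u a \<in> S"
    and drift: "\<And>a. a \<in> S \<Longrightarrow> a \<notin> D \<Longrightarrow> killed P F D V a + \<delta> \<le> V a"
    and drift': "\<And>a. a \<in> S \<Longrightarrow> killed P F D V a + \<delta> \<le> V a + b"
    and a: "a \<in> S"
  shows "\<delta> * occupation P F D a \<le> V a + b"
proof -
  let ?K = "killed P F D"
  let ?N = "\<lambda>n a. \<Sum>k<n. (?K ^^ k) (\<lambda>_. 1) a"
  note step = killed_partial_sum[of P F D]
  have le: "\<delta> * ?N n a \<le> V a" if "a \<in> S" "a \<notin> D" for n a
    using that
  proof (induction n arbitrary: a)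
    case 0
    then show ?case by simp
  next
    case (Suc n)
    have "\<delta> * ?K (?N n) a \<le> ?K V a"
      unfolding killed_cmult[symmetric] using inv Suc by (intro killed_mono) auto
    then have "\<delta> * (1 + ?K (?N n) a) \<le> ?K V a + \<delta>"
      by (simp add: distrib_left add.commute add_right_mono)
    then show ?case
      unfolding step using drift[OF Suc.prems] by (rule order_trans)
  qed
  have "\<delta> * ?N (Suc n) a \<le> V a + b" for n
  proof -
    have "\<delta> * ?K (?N n) a \<le> ?K V a"
      unfolding killed_cmult[symmetric] using inv le a by (intro killed_mono) auto
    then have "\<delta> * (1 + ?K (?N n) a) \<le> ?K V a + \<delta>"
      by (simp add: distrib_left add.commute add_right_mono)
    then show ?thesis
      unfolding step using drift'[OF a] by (rule order_trans)
  qed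
  then have *: "\<delta> * ?N n a \<le> V a + b" for n
    by (cases n) auto
  have "occupation P F D a = (SUP n. ?N n a)"
    unfolding occupation_def by (rule suminf_eq_SUP)
  then show ?thesis
    using * by (auto simp: SUP_mult_left_ennreal intro!: SUP_least)
qed

text \<open>A submartingale that vanishes on \<open>D\<close> and has integrable downward jumps is dominated by the
  expected return time. Where the latter is finite, its images under the iterated killed kernel tend
  to \<open>0\<close>, whereas those of the submartingale do not decrease.\<close>

lemma submartingale_vanishes:
  fixes V :: "'a \<Rightarrow> ennreal" and B :: "'u \<Rightarrow> ennreal"
  assumes inv: "\<And>a u. a \<in> S \<Longrightarrow> u \<in> set_pmf P \<Longrightarrow> F u a \<in> S"
    and sub: "\<And>a. a \<in> S \<Longrightarrow> V a \<le> killed P F D V a"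
    and zero: "\<And>a. a \<in> D \<Longrightarrow> V a = 0"
    and jump: "\<And>a u. a \<in> S \<Longrightarrow> V a \<le> V (F u a) + B u"
    and B: "(\<integral>\<^sup>+ u. B u \<partial>measure_pmf P) < \<infinity>"
    and Vfin: "\<And>a. a \<in> S \<Longrightarrow> V a < \<infinity>"
    and a: "a \<in> S" and N: "occupation P F D a < \<infinity>"
  shows "V a = 0"
proof -
  let ?K = "killed P F D"
  let ?N = "\<lambda>n a. \<Sum>k<n. (?K ^^ k) (\<lambda>_. 1) a"
  \<comment> \<open>The added 1 makes \<open>C\<close> positive, so that
    \<open>C * top = top\<close> settles the case of an infinite mean return time.\<close>
  define C where "C = (\<integral>\<^sup>+ u. B u \<partial>measure_pmf P) + 1"
  have C: "C < \<infinity>" "C > 0"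
    using B by (auto simp: C_def less_top intro!: add_nonneg_pos)
  have tail: "(\<lambda>k. \<Sum>n. (?K ^^ (n + k)) (\<lambda>_. 1) b) \<longlonglongrightarrow> 0" (is "?tail \<longlonglongrightarrow> _")
    if "occupation P F D b < \<infinity>" for b
  proof -
    have fin: "occupation P F D b \<noteq> top"
      using that by auto
    have split: "occupation P F D b = ?tail k + ?N k b" for k
      unfolding occupation_def by (rule suminf_offset) auto
    have finN: "?N k b \<noteq> top" for k
      using split[of k] fin by (auto simp: ennreal_add_eq_top)
    have "?tail k = occupation P F D b - ?N k b" for k
      unfolding split[of k] using finN[of k] by simp
    moreover have "(\<lambda>k. ?N k b) \<longlonglongrightarrow> occupation P F D b"
      unfolding occupation_def by (rule summable_LIMSEQ) simp
    then have "(\<lambda>k. occupation P F D b - ?N k b) \<longlonglongrightarrow> occupation P F D b - occupation P F D b"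
      using fin by (intro tendsto_diff_ennreal tendsto_const) auto
    ultimately show ?thesis
      using fin by (simp add: ennreal_minus_cancel_iff)
  qed
  have tail1: "(\<lambda>n. (?K ^^ n) (\<lambda>_. 1) b) \<longlonglongrightarrow> 0" if "occupation P F D b < \<infinity>" for b
  proof (rule tendsto_sandwich[OF _ _ tendsto_const tail[OF that]])
    show "\<forall>\<^sub>F k in sequentially. (?K ^^ k) (\<lambda>_. 1) b \<le> (\<Sum>n. (?K ^^ (n + k)) (\<lambda>_. 1) b)"
    proof (intro always_eventually allI)
      fix k
      show "(?K ^^ k) (\<lambda>_. 1) b \<le> (\<Sum>n. (?K ^^ (n + k)) (\<lambda>_. 1) b)"
        using sum_le_suminf[OF summableI, of "{0}" "\<lambda>n. (?K ^^ (n + k)) (\<lambda>_. 1) b"] by simp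
    qed
  qed simp
  \<comment> \<open>Without the cap, the term left after \<open>n\<close> steps would be a killed
    expectation of \<open>V\<close>, which is not yet under control; capping at \<open>k\<close>
    bounds it by \<open>k\<close> times a survival probability.\<close>
  have truncated: "min (V b) (of_nat k) \<le> C * ?N n b + of_nat k * (?K ^^ n) (\<lambda>_. 1) b"
    if "b \<in> S" for b n k
    using that
  proof (induction n arbitrary: b)
    case 0
    then show ?case by simp
  next
    case (Suc n)
    have "min (V b) (of_nat k) = (\<integral>\<^sup>+ u. min (V b) (of_nat k) \<partial>measure_pmf P)"
      by (simp add: measure_pmf.emeasure_space_1)
    also have "\<dots> \<le> (\<integral>\<^sup>+ u. B u + (if F u b \<in> D then 0 else min (V (F u b)) (of_nat k)) \<partial>measure_pmf P)"
    proof (rule nn_integral_mono)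
      fix u
      have "V b \<le> V (F u b) + B u"
        using jump Suc.prems by auto
      then have "min (V b) (of_nat k) \<le> min (V (F u b)) (of_nat k) + B u"
        by (auto simp: min_def intro: order_trans add_increasing2 split: if_splits)
      then show "min (V b) (of_nat k) \<le> B u + (if F u b \<in> D then 0 else min (V (F u b)) (of_nat k))"
        using zero[of "F u b"] by (auto simp: add.commute)
    qed
    also have "\<dots> = (\<integral>\<^sup>+ u. B u \<partial>measure_pmf P) + ?K (\<lambda>b. min (V b) (of_nat k)) b"
      by (simp add: killed_def nn_integral_add)
    also have "\<dots> \<le> C + ?K (\<lambda>b. C * ?N n b + of_nat k * (?K ^^ n) (\<lambda>_. 1) b) b"
      using Suc inv by (intro add_mono killed_mono) (auto simp: C_def)
    also have "\<dots> = C * (1 + ?K (\<lambda>b. ?N n b) b) + of_nat k * (?K ^^ Suc n) (\<lambda>_. 1) b"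
      by (simp add: killed_add killed_cmult distrib_left add.assoc)
    finally show ?case
      unfolding killed_partial_sum .
  qed
  have dom: "V b \<le> C * occupation P F D b" if b: "b \<in> S" for b
  proof (cases "occupation P F D b < \<infinity>")
    case True
    have le: "min (V b) (of_nat k) \<le> C * occupation P F D b" for k
    proof (rule LIMSEQ_le_const)
      have "(\<lambda>n. C * ?N n b + of_nat k * (?K ^^ n) (\<lambda>_. 1) b)
          \<longlonglongrightarrow> C * occupation P F D b + of_nat k * 0"
        unfolding occupation_def using C
        by (intro tendsto_add ennreal_tendsto_cmult tail1 True summable_LIMSEQ)
           (auto simp: ennreal_of_nat_eq_real_of_nat)
      then show "(\<lambda>n. C * ?N n b + of_nat k * (?K ^^ n) (\<lambda>_. 1) b) \<longlonglongrightarrow> C * occupation P F D b"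
        by simp
    qed (use truncated[OF b] in auto)
    obtain r where r: "V b = ennreal r" "r \<ge> 0"
      using Vfin[OF b] by (cases "V b") auto
    obtain k where "r \<le> real k"
      using real_arch_simple by blast
    then have "V b \<le> of_nat k"
      using r by (simp add: ennreal_of_nat_eq_real_of_nat)
    then show ?thesis
      using le[of k] by (simp add: min_absorb1)
  next
    case False
    then show ?thesis
      using C by (simp add: less_top[symmetric] ennreal_mult_eq_top_iff)
  qed
  have mono: "V b \<le> (?K ^^ n) V b" if "b \<in> S" for b n
    using that
  proof (induction n arbitrary: b)
    case (Suc n)
    have "V b \<le> ?K V b"
      using sub Suc.prems by auto
    also have "\<dots> \<le> ?K ((?K ^^ n) V) b"
      using Suc inv by (intro killed_mono) auto
    finally show ?case by simp
  qed simp
  have iter: "(?K ^^ n) V b \<le> C * (?K ^^ n) (occupation P F D) b" if "b \<in> S" for b n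
    using that
  proof (induction n arbitrary: b)
    case (Suc n)
    then have "?K ((?K ^^ n) V) b \<le> ?K (\<lambda>b. C * (?K ^^ n) (occupation P F D) b) b"
      using inv by (intro killed_mono) auto
    then show ?case
      by (simp add: killed_cmult)
  qed (use dom in auto)
  have "V a \<le> C * 0"
  proof (rule LIMSEQ_le_const)
    show "(\<lambda>k. C * (\<Sum>n. (?K ^^ (n + k)) (\<lambda>_. 1) a)) \<longlonglongrightarrow> C * 0"
      using C N by (intro ennreal_tendsto_cmult tail) auto
    show "\<exists>n0. \<forall>n\<ge>n0. V a \<le> C * (\<Sum>m. (?K ^^ (m + n)) (\<lambda>_. 1) a)"
      using order_trans[OF mono[OF a] iter[OF a]] by (auto simp: occupation_shift)
  qed
  then show ?thesis by simp
qed

section \<open>Expected return times\<close>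

definition hitting :: "('u \<Rightarrow> 'a \<Rightarrow> 'a) \<Rightarrow> 'a set \<Rightarrow> 'a \<Rightarrow> 'u stream \<Rightarrow> enat" where
  "hitting F D a \<omega> = Inf {enat n |n. n \<ge> 1 \<and> fold F (stake n \<omega>) a \<in> D}"

lemma less_hitting_iff:
  "enat n < hitting F D a \<omega> \<longleftrightarrow> (\<forall>k\<in>{1..n}. fold F (stake k \<omega>) a \<notin> D)"
proof
  assume *: "enat n < hitting F D a \<omega>"
  show "\<forall>k\<in>{1..n}. fold F (stake k \<omega>) a \<notin> D"
  proof (intro ballI notI)
    fix k assume k: "k \<in> {1..n}" "fold F (stake k \<omega>) a \<in> D"
    then have "hitting F D a \<omega> \<le> enat k"
      unfolding hitting_def by (intro Inf_lower) auto
    also have "\<dots> \<le> enat n" using k by simp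
    finally show False using * by simp
  qed
next
  assume *: "\<forall>k\<in>{1..n}. fold F (stake k \<omega>) a \<notin> D"
  have "enat (Suc n) \<le> hitting F D a \<omega>"
    unfolding hitting_def using * by (intro Inf_greatest) (force simp: not_less_eq_eq)
  then show "enat n < hitting F D a \<omega>"
    by (meson enat_ord_simps(2) lessI less_le_trans)
qed

text \<open>The event depends on a finite list of coded inputs. Lists of naturals form a countable
  type, so every predicate on them is measurable.\<close>

lemma measurable_survival:
  fixes h :: "'u \<Rightarrow> nat" and d :: "nat \<Rightarrow> 'u"
  shows "{\<omega>. \<forall>k\<in>{1..n}. fold F (map d (stake k (smap h \<omega>))) a \<notin> D}
    \<in> sets (stream_space (measure_pmf P))"
proof -
  let ?S = "stream_space (measure_pmf P)"
  have "Measurable.pred ?S (\<lambda>\<omega>. \<forall>k\<in>{1..n}. fold F (map d (stake k (smap h \<omega>))) a \<notin> D)"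
  proof (intro pred_intros_finite)
    fix k
    have [measurable]: "h \<in> measure_pmf P \<rightarrow>\<^sub>M count_space UNIV" by simp
    have "(\<lambda>\<omega>. stake k (smap h \<omega>)) \<in> ?S \<rightarrow>\<^sub>M count_space UNIV"
      by measurable
    then show "Measurable.pred ?S (\<lambda>\<omega>. fold F (map d (stake k (smap h \<omega>))) a \<notin> D)"
      by (rule measurable_compose) simp
  qed simp
  then show ?thesis
    by (simp add: pred_def space_stream_space)
qed

text \<open>Conditioning on the first input peels off one application of the kernel. On the support
  of \<open>P\<close> decoding inverts coding, so the coded chain follows the original one almost
  surely.\<close>

lemma survival_eq_killed:
  fixes F :: "'u \<Rightarrow> 'a \<Rightarrow> 'a" and P :: "'u pmf" and h :: "'u \<Rightarrow> nat" and d :: "nat \<Rightarrow> 'u"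
  assumes hd: "\<And>u. u \<in> set_pmf P \<Longrightarrow> d (h u) = u"
  shows "emeasure (stream_space (measure_pmf P))
      {\<omega>. \<forall>k\<in>{1..n}. fold F (map d (stake k (smap h \<omega>))) a \<notin> D} = (killed P F D ^^ n) (\<lambda>_. 1) a"
proof (induction n arbitrary: a)
  case 0
  interpret prob_space "stream_space (measure_pmf P)"
    by (rule prob_space.prob_space_stream_space[OF measure_pmf.prob_space_axioms])
  show ?case
    using emeasure_space_1 by (simp add: space_stream_space)
next
  case (Suc n)
  let ?S = "stream_space (measure_pmf P)"
  let ?E = "\<lambda>n a. {\<omega>. \<forall>k\<in>{1..n}. fold F (map d (stake k (smap h \<omega>))) a \<notin> D}"
  note meas = measurable_survival[of _ F d h _ D P]
  have shift: "indicator (?E (Suc n) a) (u ## \<omega>)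
      = (if F (d (h u)) a \<in> D then 0 else indicator (?E n (F (d (h u)) a)) \<omega> :: ennreal)" for u \<omega>
  proof -
    have *: "{1..Suc n} = insert 1 (Suc ` {1..n})"
      by (auto simp: image_Suc_atLeastAtMost)
    show ?thesis
      unfolding * by (auto simp: indicator_def simp del: image_Suc_atLeastAtMost)
  qed
  have "emeasure ?S (?E (Suc n) a) = (\<integral>\<^sup>+ \<omega>. indicator (?E (Suc n) a) \<omega> \<partial>?S)"
    using meas by (simp only: nn_integral_indicator)
  also have "\<dots> = (\<integral>\<^sup>+ u. (\<integral>\<^sup>+ \<omega>. indicator (?E (Suc n) a) (u ## \<omega>) \<partial>?S) \<partial>measure_pmf P)"
    using meas by (intro prob_space.nn_integral_stream_space[OF measure_pmf.prob_space_axioms] borel_measurable_indicator)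
  also have "\<dots> = (\<integral>\<^sup>+ u. (if F (d (h u)) a \<in> D then 0
      else (killed P F D ^^ n) (\<lambda>_. 1) (F (d (h u)) a)) \<partial>measure_pmf P)"
    unfolding shift
  proof (intro nn_integral_cong)
    fix u
    show "(\<integral>\<^sup>+ \<omega>. (if F (d (h u)) a \<in> D then 0 else indicator (?E n (F (d (h u)) a)) \<omega>) \<partial>?S)
      = (if F (d (h u)) a \<in> D then 0 else (killed P F D ^^ n) (\<lambda>_. 1) (F (d (h u)) a))"
      using Suc.IH[of "F (d (h u)) a"] meas[of n "F (d (h u)) a"]
      by (cases "F (d (h u)) a \<in> D") (simp_all only: if_True if_False nn_integral_indicator nn_integral_const mult_zero_left)
  qed
  also have "\<dots> = killed P F D ((killed P F D ^^ n) (\<lambda>_. 1)) a"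
    unfolding killed_def by (intro nn_integral_cong_AE) (auto simp: AE_measure_pmf_iff hd)
  finally show ?case by simp
qed

text \<open>The inputs form an uncountable type, on whose streams \<open>hitting\<close> need not be measurable. The
  law of a single input has countable support, however, and re-encoding the inputs by natural
  numbers changes the stream only on a null set.\<close>

lemma hitting_modification:
  fixes F :: "'u \<Rightarrow> 'a \<Rightarrow> 'a" and P :: "'u pmf"
  obtains \<tau> where
    "\<tau> \<in> stream_space (measure_pmf P) \<rightarrow>\<^sub>M count_space UNIV"
    "AE \<omega> in stream_space (measure_pmf P). hitting F D a \<omega> = \<tau> \<omega>"
    "(\<integral>\<^sup>+ \<omega>. ennreal_of_enat (\<tau> \<omega>) \<partial>stream_space (measure_pmf P)) = occupation P F D a"
proof
  let ?S = "stream_space (measure_pmf P)"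
  define h where "h = to_nat_on (set_pmf P)"
  define d where "d = from_nat_into (set_pmf P)"
  define \<tau> where "\<tau> \<omega> = hitting F D a (smap d (smap h \<omega>))" for \<omega>
  have hd: "d (h u) = u" if "u \<in> set_pmf P" for u
    using that by (simp add: h_def d_def countable_set_pmf)
  have stake: "stake n (smap d (smap h \<omega>)) = map d (stake n (smap h \<omega>))" for n \<omega>
    by (rule stake_smap)
  have surv: "emeasure ?S {\<omega> \<in> space ?S. enat n < \<tau> \<omega>} = (killed P F D ^^ n) (\<lambda>_. 1) a" for n
    unfolding \<tau>_def less_hitting_iff stake
    using survival_eq_killed[of P d h n F a D, OF hd] by (simp add: space_stream_space)
  show meas: "\<tau> \<in> ?S \<rightarrow>\<^sub>M count_space UNIV"
  proof (rule measurableI)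
    fix A :: "enat set"
    have "\<tau> -` {x} \<inter> space ?S \<in> sets ?S" for x
    proof -
      \<comment> \<open>An extended natural is determined by the naturals below it, so the survival
        events describe the preimages of single values; countably many of these make up any
        preimage.\<close>
      have "\<exists>n. enat n < y \<and> \<not> enat n < z" if "z < y" for y z :: enat
        using that by (cases z) auto
      then have "y = x \<longleftrightarrow> (\<forall>n. enat n < y \<longleftrightarrow> enat n < x)" for y
        by (cases y x rule: linorder_cases) blast+
      then have *: "\<tau> -` {x} \<inter> space ?S = {\<omega> \<in> space ?S. \<forall>n. enat n < \<tau> \<omega> \<longleftrightarrow> enat n < x}"
        by auto
      have [measurable]: "Measurable.pred ?S (\<lambda>\<omega>. enat n < \<tau> \<omega>)" for n
        unfolding \<tau>_def less_hitting_iff stake using measurable_survival[of n F d h a D P]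
        by (simp add: pred_def space_stream_space)
      show ?thesis
        unfolding * by measurable
    qed
    then have "(\<Union>x\<in>A. \<tau> -` {x} \<inter> space ?S) \<in> sets ?S"
      by (intro sets.countable_UN') auto
    also have "(\<Union>x\<in>A. \<tau> -` {x} \<inter> space ?S) = \<tau> -` A \<inter> space ?S"
      by auto
    finally show "\<tau> -` A \<inter> space ?S \<in> sets ?S" .
  qed simp
  show "AE \<omega> in ?S. hitting F D a \<omega> = \<tau> \<omega>"
  proof -
    have "AE \<omega> in ?S. stream_all (\<lambda>u. u \<in> set_pmf P) \<omega>"
      by (rule prob_space.AE_stream_all[OF measure_pmf.prob_space_axioms]) (auto simp: AE_measure_pmf)
    then show ?thesis
    proof eventually_elim
      case (elim \<omega>)
      have "smap d (smap h \<omega>) = \<omega>"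
        using elim hd by (auto simp: stream.map_comp intro!: stream.map_ident_strong simp: stream_all_def sset_range)
      then show ?case
        by (simp add: \<tau>_def)
    qed
  qed
  show "(\<integral>\<^sup>+ \<omega>. ennreal_of_enat (\<tau> \<omega>) \<partial>?S) = occupation P F D a"
    unfolding nn_integral_enat_function[OF meas] surv occupation_def ..
qed

lemma nn_integral_hitting:
  "(\<integral>\<^sup>+ \<omega>. ennreal_of_enat (hitting F D a \<omega>) \<partial>stream_space (measure_pmf P)) = occupation P F D a"
proof -
  obtain \<tau> where \<tau>: "AE \<omega> in stream_space (measure_pmf P). hitting F D a \<omega> = \<tau> \<omega>"
    "(\<integral>\<^sup>+ \<omega>. ennreal_of_enat (\<tau> \<omega>) \<partial>stream_space (measure_pmf P)) = occupation P F D a"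
    by (rule hitting_modification)
  show ?thesis
    unfolding \<tau>(2)[symmetric] using \<tau>(1) by (intro nn_integral_cong_AE) auto
qed

lemma AE_hitting_finite:
  assumes "occupation P F D a < \<infinity>"
  shows "AE \<omega> in stream_space (measure_pmf P). hitting F D a \<omega> < \<infinity>"
proof -
  obtain \<tau> where [measurable]: "\<tau> \<in> stream_space (measure_pmf P) \<rightarrow>\<^sub>M count_space UNIV"
    and \<tau>: "AE \<omega> in stream_space (measure_pmf P). hitting F D a \<omega> = \<tau> \<omega>"
    "(\<integral>\<^sup>+ \<omega>. ennreal_of_enat (\<tau> \<omega>) \<partial>stream_space (measure_pmf P)) = occupation P F D a"
    by (rule hitting_modification)
  have "AE \<omega> in stream_space (measure_pmf P). ennreal_of_enat (\<tau> \<omega>) \<noteq> \<infinity>"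
    using assms by (intro nn_integral_noteq_infinite) (auto simp: \<tau>(2))
  then show ?thesis
    using \<tau>(1)
  proof eventually_elim
    case (elim \<omega>)
    then show ?case
      by (cases "\<tau> \<omega>") auto
  qed
qed

section \<open>A smoothed positive part\<close>

definition slope :: "real \<Rightarrow> real \<Rightarrow> real" where
  "slope L x = max 0 (min 1 (x / L))"

text \<open>For \<open>L > 0\<close> this is \<open>0\<close> up to \<open>0\<close>,
  \<open>x\<^sup>2 / (2 * L)\<close> between \<open>0\<close> and \<open>L\<close>, and
  \<open>x - L / 2\<close> beyond, with derivative \<open>slope L\<close>. The form chosen shows it
  as the maximum of \<open>m * x - m\<^sup>2 * L / 2\<close> over \<open>m\<close> in the unit
  interval, attained at \<open>m = slope L x\<close>.\<close>

definition huber :: "real \<Rightarrow> real \<Rightarrow> real" where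
  "huber L x = slope L x * x - (slope L x)\<^sup>2 * L / 2"

lemma slope_bounds: "0 \<le> slope L x" "slope L x \<le> 1"
  by (auto simp: slope_def)

lemma slope_mono: "L > 0 \<Longrightarrow> x \<le> y \<Longrightarrow> slope L x \<le> slope L y"
  by (auto simp: slope_def max_def min_def divide_simps)

lemma slope_eq_0: "L > 0 \<Longrightarrow> x \<le> 0 \<Longrightarrow> slope L x = 0"
  by (auto simp: slope_def max_def min_def divide_simps)

lemma slope_eq_1: "L > 0 \<Longrightarrow> L \<le> x \<Longrightarrow> slope L x = 1"
  by (auto simp: slope_def max_def min_def divide_simps)

lemma slope_lipschitz: "L > 0 \<Longrightarrow> \<bar>slope L x - slope L y\<bar> \<le> \<bar>x - y\<bar> / L"
  by (auto simp: slope_def max_def min_def divide_simps abs_if)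

text \<open>A concave quadratic in \<open>m\<close> is maximal on the unit interval at its clipped
  vertex \<open>x / L\<close>. Nonnegativity, the linear lower bound and the tangent bound below are
  choices of \<open>m\<close>.\<close>

lemma huber_ge:
  assumes L: "L > 0" and m: "0 \<le> m" "m \<le> 1"
  shows "m * x - m\<^sup>2 * L / 2 \<le> huber L x"
proof -
  define y where "y = x / L"
  have x: "x = y * L" using L by (simp add: y_def)
  have *: "m * y - m\<^sup>2 / 2 \<le> slope L x * y - (slope L x)\<^sup>2 / 2"
  proof -
    consider "y \<le> 0" | "0 \<le> y" "y \<le> 1" | "y > 1" by linarith
    then show ?thesis
    proof cases
      case 1
      have "m * y \<le> 0" using 1 m by (simp add: mult_nonneg_nonpos)
      moreover have "0 \<le> m\<^sup>2" by simp
      ultimately have "m * y - m\<^sup>2 / 2 \<le> 0" by linarith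
      then show ?thesis using 1 by (simp add: slope_def y_def[symmetric])
    next
      case 2
      have "0 \<le> (y - m)\<^sup>2" by simp
      then show ?thesis using 2
        by (simp add: slope_def y_def[symmetric] power2_eq_square algebra_simps)
    next
      case 3
      have "0 \<le> (1 - m) * (y - 1) + (1 - m)\<^sup>2 / 2" using 3 m by simp
      then show ?thesis using 3
        by (simp add: slope_def y_def[symmetric] power2_eq_square field_simps)
    qed
  qed
  have "m * x - m\<^sup>2 * L / 2 = L * (m * y - m\<^sup>2 / 2)"
    by (simp add: x algebra_simps)
  also have "\<dots> \<le> L * (slope L x * y - (slope L x)\<^sup>2 / 2)"
    using * L by (intro mult_left_mono) auto
  also have "\<dots> = huber L x"
    unfolding huber_def by (simp add: x algebra_simps)
  finally show ?thesis .
qed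

lemma huber_nonneg: "L > 0 \<Longrightarrow> 0 \<le> huber L x"
  using huber_ge[of L 0 x] by simp

lemma huber_ge_linear: "L > 0 \<Longrightarrow> x - L / 2 \<le> huber L x"
  using huber_ge[of L 1 x] by simp

text \<open>Convexity, with the tangent taken at the endpoint: apply \<open>huber_ge\<close> at
  \<open>x\<close> with the slope of the endpoint as multiplier.\<close>

lemma huber_le_tangent: "L > 0 \<Longrightarrow> huber L (x + d) \<le> huber L x + slope L (x + d) * d"
  using huber_ge[of L "slope L (x + d)" x] slope_bounds[of L "x + d"]
  by (simp add: huber_def algebra_simps)

lemma huber_le:
  assumes "L > 0" "x \<le> b" "0 \<le> b"
  shows "huber L x \<le> b"
proof -
  have "slope L x * x \<le> slope L x * b"
    using assms slope_bounds[of L x] by (intro mult_left_mono) auto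
  also have "\<dots> \<le> 1 * b"
    using assms slope_bounds[of L x] by (intro mult_right_mono) auto
  finally show ?thesis
    using assms by (simp add: huber_def add_increasing2 diff_le_eq)
qed

text \<open>Replacing the slope at the endpoint by that at \<open>x\<close> costs the change of
  slope times \<open>d\<close>. The slope changes by at most \<open>1\<close> and by at most
  \<open>b / L\<close>: the first bound keeps the error integrable under a first moment, the second
  makes it small for large \<open>L\<close>.\<close>

lemma huber_increment:
  assumes "L > 0" "\<bar>d\<bar> \<le> b"
  shows "huber L (x + d) \<le> huber L x + slope L x * d + min b (b\<^sup>2 / L)"
proof -
  define k where "k = slope L (x + d) - slope L x"
  have k: "\<bar>k\<bar> \<le> 1" "\<bar>k\<bar> \<le> b / L"
  proof -
    show "\<bar>k\<bar> \<le> 1"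
      unfolding k_def using slope_bounds[of L x] slope_bounds[of L "x + d"] by linarith
    have "\<bar>k\<bar> \<le> \<bar>d\<bar> / L"
      unfolding k_def using slope_lipschitz[of L "x + d" x] assms by simp
    also have "\<dots> \<le> b / L" using assms by (intro divide_right_mono) auto
    finally show "\<bar>k\<bar> \<le> b / L" .
  qed
  have "k * d \<le> \<bar>k\<bar> * \<bar>d\<bar>" by (simp flip: abs_mult)
  moreover have "\<bar>k\<bar> * \<bar>d\<bar> \<le> 1 * b" "\<bar>k\<bar> * \<bar>d\<bar> \<le> b / L * b"
    using assms k by (intro mult_mono; auto)+
  ultimately have "k * d \<le> min b (b\<^sup>2 / L)"
    by (simp add: power2_eq_square)
  moreover have "slope L (x + d) * d = slope L x * d + k * d"
    by (simp add: k_def algebra_simps)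
  ultimately show ?thesis
    using huber_le_tangent[of L x d] assms by linarith
qed

lemma huber_lipschitz:
  assumes "L > 0"
  shows "\<bar>huber L x - huber L y\<bar> \<le> \<bar>x - y\<bar>"
proof -
  have "huber L x - huber L y \<le> \<bar>x - y\<bar>" for x y
  proof -
    have "slope L x * (x - y) \<le> \<bar>slope L x\<bar> * \<bar>x - y\<bar>" by (simp flip: abs_mult)
    also have "\<dots> \<le> 1 * \<bar>x - y\<bar>" using slope_bounds[of L x] by (intro mult_right_mono) auto
    finally show ?thesis using huber_le_tangent[OF assms, of y "x - y"] by simp
  qed
  from this[of x y] this[of y x] show ?thesis by simp
qed

lemma huber_0: "huber L 0 = 0"
  by (simp add: huber_def slope_def)

lemma huber_expectation:
  fixes P :: "'u pmf"
  assumes L: "L > 0" and B: "integrable P B" and X: "integrable P X"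
    and bound: "\<And>u. \<bar>X u - x\<bar> \<le> B u"
  shows "integrable P (\<lambda>u. huber L (X u))"
    and "measure_pmf.expectation P (\<lambda>u. huber L (X u))
      \<le> huber L x + slope L x * (measure_pmf.expectation P X - x)
        + measure_pmf.expectation P (\<lambda>u. min (B u) ((B u)\<^sup>2 / L))"
proof -
  show int: "integrable P (\<lambda>u. huber L (X u))"
  proof (rule Bochner_Integration.integrable_bound[OF X])
    show "AE u in P. norm (huber L (X u)) \<le> norm (X u)"
      using huber_lipschitz[OF L, of _ 0] by (simp add: huber_0)
  qed simp
  have B0: "0 \<le> B u" for u using bound[of u] by linarith
  have err: "integrable P (\<lambda>u. min (B u) ((B u)\<^sup>2 / L))"
    by (rule Bochner_Integration.integrable_bound[OF B]) (use B0 L in \<open>auto simp: min_def\<close>)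
  have "measure_pmf.expectation P (\<lambda>u. huber L (X u))
      \<le> measure_pmf.expectation P (\<lambda>u. huber L x + slope L x * (X u - x) + min (B u) ((B u)\<^sup>2 / L))"
    using int err X huber_increment[OF L bound, where x = x] by (intro integral_mono) auto
  also have "\<dots> = huber L x + slope L x * (measure_pmf.expectation P X - x)
        + measure_pmf.expectation P (\<lambda>u. min (B u) ((B u)\<^sup>2 / L))"
    using err X by simp
  finally show "measure_pmf.expectation P (\<lambda>u. huber L (X u))
      \<le> huber L x + slope L x * (measure_pmf.expectation P X - x)
        + measure_pmf.expectation P (\<lambda>u. min (B u) ((B u)\<^sup>2 / L))" .
qed

text \<open>Dominated convergence with majorant \<open>B\<close>: the integrand tends to
  \<open>0\<close> pointwise as \<open>L\<close> grows. This stands in for a second-moment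
  bound.\<close>

lemma small_error:
  fixes P :: "'u pmf" and B :: "'u \<Rightarrow> real"
  assumes B: "integrable P B" "\<And>u. 0 \<le> B u" and e: "e > 0"
  obtains L :: real where "L \<ge> 1" "measure_pmf.expectation P (\<lambda>u. min (B u) ((B u)\<^sup>2 / L)) < e"
proof -
  have "(\<lambda>n. measure_pmf.expectation P (\<lambda>u. min (B u) ((B u)\<^sup>2 / real (Suc n))))
      \<longlonglongrightarrow> measure_pmf.expectation P (\<lambda>u. 0)"
  proof (rule integral_dominated_convergence[where w = B])
    show "AE u in P. (\<lambda>n. min (B u) ((B u)\<^sup>2 / real (Suc n))) \<longlonglongrightarrow> 0"
    proof (intro AE_I2)
      fix u
      have "(\<lambda>n. (B u)\<^sup>2 * inverse (real (Suc n))) \<longlonglongrightarrow> (B u)\<^sup>2 * 0"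
        by (intro tendsto_mult tendsto_const LIMSEQ_inverse_real_of_nat)
      then have "(\<lambda>n. min (B u) ((B u)\<^sup>2 / real (Suc n))) \<longlonglongrightarrow> min (B u) 0"
        by (intro tendsto_min tendsto_const) (simp add: divide_inverse)
      then show "(\<lambda>n. min (B u) ((B u)\<^sup>2 / real (Suc n))) \<longlonglongrightarrow> 0"
        using B(2)[of u] by (simp add: min_absorb2)
    qed
    show "AE u in P. norm (min (B u) ((B u)\<^sup>2 / real (Suc n))) \<le> B u" for n
      using B(2) by (intro AE_I2) (auto simp: min_def)
  qed (use B in auto)
  then have "\<forall>\<^sub>F n in sequentially. measure_pmf.expectation P (\<lambda>u. min (B u) ((B u)\<^sup>2 / real (Suc n))) < e"
    using e by (intro order_tendstoD(2)[of _ 0]) auto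
  then obtain n where "measure_pmf.expectation P (\<lambda>u. min (B u) ((B u)\<^sup>2 / real (Suc n))) < e"
    by (auto simp: eventually_sequentially)
  then show ?thesis
    using that[of "real (Suc n)"] by simp
qed

section \<open>Moments of the inputs\<close>

lemma nn_integral_count_list_replicate_pmf:
  assumes "finite A" "A \<noteq> {}" "i \<in> A"
  shows "(\<integral>\<^sup>+ xs. ennreal (real (count_list xs i)) \<partial>measure_pmf (replicate_pmf m (pmf_of_set A)))
    = ennreal (real m / real (card A))"
proof (induction m)
  case 0
  then show ?case by simp
next
  case (Suc m)
  have "(\<integral>\<^sup>+ xs. ennreal (real (count_list xs i)) \<partial>measure_pmf (replicate_pmf (Suc m) (pmf_of_set A)))
    = (\<integral>\<^sup>+ x. \<integral>\<^sup>+ xs. (indicator {i} x + ennreal (real (count_list xs i)))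
        \<partial>measure_pmf (replicate_pmf m (pmf_of_set A)) \<partial>measure_pmf (pmf_of_set A))"
    by (auto intro!: nn_integral_cong split: split_indicator)
  also have "\<dots> = (\<integral>\<^sup>+ x. (indicator {i} x + ennreal (real m / real (card A))) \<partial>measure_pmf (pmf_of_set A))"
    by (simp add: nn_integral_add Suc.IH measure_pmf.emeasure_space_1)
  also have "\<dots> = ennreal (1 / real (card A)) + ennreal (real m / real (card A))"
    using assms by (simp add: nn_integral_add measure_pmf.emeasure_space_1 emeasure_pmf_single)
  also have "\<dots> = ennreal (real (Suc m) / real (card A))"
    by (simp add: ennreal_plus[symmetric] add_divide_distrib del: ennreal_plus)
  finally show ?case .
qed

lemma map_pmf_mac_input:
  fixes M p red green
  defines "P \<equiv> mac_input_pmf M p red green"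
  shows "map_pmf fst P = bind_pmf red (\<lambda>m. map_pmf count_list (replicate_pmf m (pmf_of_set {1..M})))"
    and "map_pmf (fst \<circ> snd) P = bind_pmf green (\<lambda>m. map_pmf count_list (replicate_pmf m (pmf_of_set {1..M})))"
    and "map_pmf (snd \<circ> snd) P = Pi_pmf {1..M} False (\<lambda>_. bernoulli_pmf p)"
  by (simp_all add: P_def mac_input_pmf_def map_pmf_def bind_assoc_pmf bind_return_pmf bind_return_pmf')

lemma count_list_bind_moments:
  assumes "M \<ge> 1" "i \<in> {1..M}" "integrable (measure_pmf law) real"
    and Q: "Q = bind_pmf law (\<lambda>m. map_pmf count_list (replicate_pmf m (pmf_of_set {1..M})))"
  shows "integrable Q (\<lambda>\<xi>. real (\<xi> i))"
    and "measure_pmf.expectation Q (\<lambda>\<xi>. real (\<xi> i)) = measure_pmf.expectation law real / real M"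
proof -
  have "(\<integral>\<^sup>+ \<xi>. ennreal (real (\<xi> i)) \<partial>measure_pmf Q) = (\<integral>\<^sup>+ m. ennreal (real m / real M) \<partial>measure_pmf law)"
    using assms by (simp add: Q nn_integral_bind_pmf nn_integral_count_list_replicate_pmf)
  also have "\<dots> = ennreal (measure_pmf.expectation law (\<lambda>m. real m / real M))"
    using assms by (intro nn_integral_eq_integral) auto
  finally have *: "(\<integral>\<^sup>+ \<xi>. ennreal (real (\<xi> i)) \<partial>measure_pmf Q) = ennreal (measure_pmf.expectation law real / real M)"
    by simp
  then show int: "integrable Q (\<lambda>\<xi>. real (\<xi> i))"
    by (intro integrableI_nonneg) auto
  have "ennreal (measure_pmf.expectation Q (\<lambda>\<xi>. real (\<xi> i))) = ennreal (measure_pmf.expectation law real / real M)"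
    using * int by (subst (asm) nn_integral_eq_integral) auto
  then show "measure_pmf.expectation Q (\<lambda>\<xi>. real (\<xi> i)) = measure_pmf.expectation law real / real M"
    by (subst (asm) ennreal_inj) auto
qed

lemma mac_input_support:
  assumes "M \<ge> 1" "u \<in> set_pmf (mac_input_pmf M p red green)" "i \<notin> {1..M}"
  shows "fst u i = 0" "fst (snd u) i = 0"
proof -
  have set: "set_pmf (pmf_of_set {1..M}) = {1..M}"
    using assms(1) by (intro set_pmf_of_set) auto
  have "count_list xs i = 0" if "xs \<in> set_pmf (replicate_pmf n (pmf_of_set {1..M}))" for xs n
    using that assms(3) unfolding set_replicate_pmf set by (intro count_notin) auto
  then show "fst u i = 0" "fst (snd u) i = 0"
    using assms(2) by (auto simp: mac_input_pmf_def)
qed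

text \<open>A slot of positive probability that raises one chosen green queue, adds no red message
  and lets nobody attempt; \<open>p < 1\<close> makes the silence possible. Such slots drive the
  chain to large potentials in the instability proof.\<close>

lemma mac_input_witness:
  assumes "M \<ge> 1" "0 \<le> p" "p < 1" "0 \<in> set_pmf red" "n \<in> set_pmf green" "k \<in> {1..M}"
  shows "(\<lambda>_. 0, \<lambda>i. if i = k then n else 0, \<lambda>_. False) \<in> set_pmf (mac_input_pmf M p red green)"
proof -
  have count: "count_list (replicate n k) = (\<lambda>i. if i = k then n else 0)" "count_list [] = (\<lambda>_. 0 :: nat)"
    by (induction n) (auto simp: fun_eq_iff)
  have dest: "replicate n k \<in> set_pmf (replicate_pmf n (pmf_of_set {1..M}))"
    using assms by (auto simp: set_replicate_pmf)
  have silent: "(\<lambda>_. False) \<in> set_pmf (Pi_pmf {1..M} False (\<lambda>_. bernoulli_pmf p))"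
    using assms by (auto simp: set_Pi_pmf PiE_dflt_def set_pmf_iff)
  have "(count_list [], count_list (replicate n k), \<lambda>_. False) \<in> set_pmf (mac_input_pmf M p red green)"
    unfolding mac_input_pmf_def set_bind_pmf
    by (rule UN_I[OF assms(4)], rule UN_I[OF assms(5)], rule UN_I[where a = "[]"], simp,
        rule UN_I[OF dest], rule UN_I[OF silent], simp)
  then show ?thesis
    unfolding count .
qed

section \<open>Green departures\<close>

definition solo :: "(nat \<Rightarrow> bool) \<Rightarrow> nat \<Rightarrow> nat set \<Rightarrow> real" where
  "solo \<alpha> i T = of_bool (\<alpha> i \<and> (\<forall>j\<in>T. \<not> \<alpha> j))"

lemma expectation_solo:
  assumes "finite A" "i \<in> A" "T \<subseteq> A - {i}" "0 \<le> p" "p \<le> 1"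
  shows "measure_pmf.expectation (Pi_pmf A d (\<lambda>_. bernoulli_pmf p)) (\<lambda>\<alpha>. solo \<alpha> i T) = p * (1 - p) ^ card T"
proof -
  \<comment> \<open>One factor per station turns the event into a product over all of
    \<open>A\<close>, to which independence applies.\<close>
  define f :: "nat \<Rightarrow> bool \<Rightarrow> real" where
    "f j v = (if j = i then of_bool v else if j \<in> T then of_bool (\<not> v) else 1)" for j v
  have fin: "finite T"
    using assms finite_subset by blast
  have "(\<Prod>j\<in>A. f j (\<alpha> j)) = solo \<alpha> i T" for \<alpha>
  proof -
    have "(\<Prod>j\<in>A. f j (\<alpha> j)) = of_bool (\<alpha> i) * (\<Prod>j\<in>A - {i}. f j (\<alpha> j))"
      using assms by (subst prod.remove[of _ i]) (auto simp: f_def)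
    also have "(\<Prod>j\<in>A - {i}. f j (\<alpha> j)) = (\<Prod>j\<in>T. of_bool (\<not> \<alpha> j))"
      using assms by (intro prod.mono_neutral_cong_right) (auto simp: f_def)
    also have "\<dots> = of_bool (\<forall>j\<in>T. \<not> \<alpha> j)"
      using fin by induction auto
    finally show ?thesis
      by (simp add: solo_def)
  qed
  then have "measure_pmf.expectation (Pi_pmf A d (\<lambda>_. bernoulli_pmf p)) (\<lambda>\<alpha>. solo \<alpha> i T)
      = measure_pmf.expectation (Pi_pmf A d (\<lambda>_. bernoulli_pmf p)) (\<lambda>\<alpha>. \<Prod>j\<in>A. f j (\<alpha> j))"
    by simp
  also have "\<dots> = (\<Prod>j\<in>A. measure_pmf.expectation (bernoulli_pmf p) (f j))"
    using assms by (intro expectation_prod_Pi_pmf) (auto simp: f_def integrable_measure_pmf_finite)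
  also have "\<dots> = p * (\<Prod>j\<in>A - {i}. measure_pmf.expectation (bernoulli_pmf p) (f j))"
    using assms by (subst prod.remove[of _ i]) (auto simp: f_def)
  also have "(\<Prod>j\<in>A - {i}. measure_pmf.expectation (bernoulli_pmf p) (f j)) = (\<Prod>j\<in>T. 1 - p)"
    using assms by (intro prod.mono_neutral_cong_right) (auto simp: f_def)
  finally show ?thesis
    by simp
qed

lemma prod_one_minus_attempt:
  "finite A \<Longrightarrow> (\<Prod>j\<in>A. 1 - attempt \<alpha> G j) = of_bool (\<forall>j\<in>A. \<not> (\<alpha> j \<and> G j > 0))"
  by (induction A rule: finite_induct) (auto simp: attempt_def)

lemma green_departure_attempt:
  "green_departure M c R (attempt \<alpha> G) i
    = (if i = c then of_bool (R i = 0 \<and> \<alpha> i \<and> G i > 0 \<and> (\<forall>j\<in>{1..M} - {i}. \<not> (\<alpha> j \<and> G j > 0)))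
       else of_bool (\<alpha> i \<and> G i > 0 \<and> (\<forall>j\<in>{1..M} - {i, c}. \<not> (\<alpha> j \<and> G j > 0))
          \<and> \<not> (\<alpha> c \<and> G c > 0 \<and> R c = 0)))"
proof -
  have prod: "(\<Prod>j\<in>{1..M} - {i}. 1 - attempt \<alpha> G j) = of_bool (\<forall>j\<in>{1..M} - {i}. \<not> (\<alpha> j \<and> G j > 0))"
    "(\<Prod>j\<in>{1..M} - {i, c}. 1 - attempt \<alpha> G j) = of_bool (\<forall>j\<in>{1..M} - {i, c}. \<not> (\<alpha> j \<and> G j > 0))"
    by (intro prod_one_minus_attempt; simp)+
  show ?thesis
    unfolding green_departure_def prod by (auto simp: attempt_def)
qed

lemma green_departure_le:
  "green_departure M c R (attempt \<alpha> G) i \<le> 1" "green_departure M c R (attempt \<alpha> G) i \<le> G i"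
  by (auto simp: green_departure_attempt)

text \<open>The number of departures from station \<open>i\<close> if all green buffers are non-empty; \<open>b\<close> says whether
  the coordinator transmits a red message.\<close>

definition saturated_departure :: "nat \<Rightarrow> nat \<Rightarrow> bool \<Rightarrow> (nat \<Rightarrow> bool) \<Rightarrow> nat \<Rightarrow> real" where
  "saturated_departure M c b \<alpha> i =
     (if b then (if i = c then 0 else solo \<alpha> i ({1..M} - {i, c})) else solo \<alpha> i ({1..M} - {i}))"

text \<open>Empty green buffers only remove contenders, so a non-empty station succeeds whenever it
  would under saturation.\<close>

lemma saturated_departure_le:
  assumes "c \<in> {1..M}" "G i > 0"
  shows "saturated_departure M c (R c > 0) \<alpha> i \<le> real (green_departure M c R (attempt \<alpha> G) i)"
  using assms by (auto simp: saturated_departure_def green_departure_attempt solo_def)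

lemma saturated_departure_eq:
  assumes "c \<in> {1..M}" "i \<in> {1..M}" "\<And>j. j \<in> {1..M} \<Longrightarrow> G j > 0"
  shows "real (green_departure M c R (attempt \<alpha> G) i) = saturated_departure M c (R c > 0) \<alpha> i"
  using assms by (auto simp: saturated_departure_def green_departure_attempt solo_def)

lemma expectation_saturated_departure:
  assumes "c \<in> {1..M}" "i \<in> {1..M}" "0 \<le> p" "p \<le> 1"
  shows "measure_pmf.expectation (Pi_pmf {1..M} False (\<lambda>_. bernoulli_pmf p)) (\<lambda>\<alpha>. saturated_departure M c b \<alpha> i)
    = (if b then (if i = c then 0 else p * (1 - p) ^ (M - 2)) else p * (1 - p) ^ (M - 1))"
proof -
  have "card ({1..M} - {i}) = M - 1"
    using assms by simp
  \<comment> \<open>Two distinct stations force \<open>M \<ge> 2\<close>, so the truncated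
    \<open>M - 2\<close> is the true number of rivals.\<close>
  moreover have "card ({1..M} - {i, c}) = M - 2" if "i \<noteq> c"
    using assms that by (subst card_Diff_subset) auto
  moreover have "{1..M} - {i, c} \<subseteq> {1..M} - {i}" "{1..M} - {i} \<subseteq> {1..M} - {i}"
    by auto
  note this[THEN expectation_solo[OF finite_atLeastAtMost assms(2) _ assms(3,4), where d = False]]
  ultimately show ?thesis
    by (cases b; cases "i = c") (simp_all only: saturated_departure_def if_True if_False refl Bochner_Integration.integral_zero simp_thms)
qed

section \<open>Drifts\<close>

locale mac_network =
  fixes M :: nat and p :: real and red green :: "nat pmf"
  assumes M: "M \<ge> 1" and p: "0 < p" "p < 1"
    and integrable_red: "integrable (measure_pmf red) real"
    and integrable_green: "integrable (measure_pmf green) real"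
begin

abbreviation P :: "mac_input pmf" where
  "P \<equiv> mac_input_pmf M p red green"

definition red_rate :: real where
  "red_rate = measure_pmf.expectation red real"

definition green_rate :: real where
  "green_rate = measure_pmf.expectation green real"

definition q :: real where
  "q = p * (1 - p) ^ (M - 1)"

definition q' :: real where
  "q' = p * (1 - p) ^ (M - 2)"

text \<open>Heuristically, a fraction \<open>red_rate\<close> of the slots carries a red message and
  leaves \<open>M - 1\<close> contenders. With \<open>M = 1\<close> the truncated exponent gives
  \<open>q' = q = p\<close>, while the factor \<open>real M - 1\<close> makes the first term vanish,
  so one formula covers both cases of the theorem.\<close>

definition capacity :: real where
  "capacity = red_rate * (real M - 1) * q' + (1 - red_rate) * real M * q"

text \<open>If all green buffers are non-empty, station \<open>i\<close> transmits a green message with probability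
  \<open>q\<close> when the coordinator \<open>c\<close> has no red message, and with probability \<open>q + coef i c\<close> otherwise.
  Subtracting the \<open>coef\<close>-weighted red queues from the green one makes the drift constant.\<close>

definition coef :: "nat \<Rightarrow> nat \<Rightarrow> real" where
  "coef i j = (if j = i then - q else q' - q)"

definition Z :: "mac_state \<Rightarrow> nat \<Rightarrow> real" where
  "Z x i = real (snd x i) - (\<Sum>j\<in>{1..M}. coef i j * real (fst x j))"

text \<open>The number of slots until station \<open>j\<close> becomes the coordinator, divided by \<open>M\<close>.\<close>

definition phase :: "nat \<Rightarrow> nat \<Rightarrow> real" where
  "phase c j = real ((j + M - c) mod M) / real M"

definition W :: "nat \<Rightarrow> mac_state \<Rightarrow> nat \<Rightarrow> real" where
  "W c x j = real (fst x j) + phase c j"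

text \<open>The 2 covers one green departure and one red departure, the latter weighted by a
  coefficient of modulus at most 1.\<close>

definition jump_bound :: "mac_input \<Rightarrow> real" where
  "jump_bound u = (\<Sum>i\<in>{1..M}. real (fst u i) + real (fst (snd u) i)) + 2"

abbreviation departure :: "nat \<Rightarrow> mac_state \<Rightarrow> mac_input \<Rightarrow> nat \<Rightarrow> nat" where
  "departure c x u i \<equiv> green_departure M c (fst x) (attempt (snd (snd u)) (snd x)) i"

lemma q_bounds: "0 < q" "q \<le> 1" "q \<le> q'" "q' \<le> 1"
proof -
  have le1: "p * (1 - p) ^ n \<le> 1" for n
    using p by (intro mult_le_one power_le_one) auto
  show "0 < q" "q \<le> 1" "q' \<le> 1"
    using p le1 by (auto simp: q_def q'_def)
  show "q \<le> q'"
    unfolding q_def q'_def using p by (intro mult_left_mono power_decreasing) auto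
qed

lemma coef_bound: "\<bar>coef i j\<bar> \<le> 1"
  using q_bounds by (auto simp: coef_def)

text \<open>That the value does not depend on \<open>i\<close> is what gives every
  \<open>Z x i\<close> the same saturated drift.\<close>

lemma sum_coef: "i \<in> {1..M} \<Longrightarrow> (\<Sum>j\<in>{1..M}. coef i j) = (real M - 1) * q' - real M * q"
proof -
  assume i: "i \<in> {1..M}"
  then have "(\<Sum>j\<in>{1..M}. coef i j) = - q + (\<Sum>j\<in>{1..M} - {i}. q' - q)"
    by (subst sum.remove[of _ i]) (auto simp: coef_def intro!: sum.cong)
  then show ?thesis
    using i by (simp add: of_nat_diff algebra_simps)
qed

lemma red_rate_nonneg: "0 \<le> red_rate"
  by (simp add: red_rate_def)

lemma fst_step:
  "real (fst (mac_step M c u x) i) = real (fst x i) + real (fst u i) - of_bool (i = c \<and> fst x i > 0)"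
  by (cases u; cases x) (auto simp: red_departure_def of_nat_diff)

lemma snd_step:
  "real (snd (mac_step M c u x) i) = real (snd x i) + real (fst (snd u) i) - real (departure c x u i)"
proof (cases u; cases x)
  fix \<xi> \<eta> \<alpha> R G
  assume "u = (\<xi>, \<eta>, \<alpha>)" "x = (R, G)"
  then show ?thesis
    using green_departure_le(2)[of M c R \<alpha> G i] by (simp add: of_nat_diff)
qed

lemma
  assumes "i \<in> {1..M}"
  shows integrable_red_input: "integrable P (\<lambda>u. real (fst u i))"
    and expectation_red_input: "measure_pmf.expectation P (\<lambda>u. real (fst u i)) = red_rate / real M"
  using count_list_bind_moments[OF M assms integrable_red map_pmf_mac_input(1)]
  by (simp_all add: red_rate_def)

lemma
  assumes "i \<in> {1..M}"
  shows integrable_green_input: "integrable P (\<lambda>u. real (fst (snd u) i))"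
    and expectation_green_input: "measure_pmf.expectation P (\<lambda>u. real (fst (snd u) i)) = green_rate / real M"
  using count_list_bind_moments[OF M assms integrable_green map_pmf_mac_input(2)]
  by (simp_all add: green_rate_def)

lemma integrable_departure: "integrable P (\<lambda>u. real (departure c x u i))"
  by (rule measure_pmf.integrable_const_bound[where B = 1]) (simp_all add: green_departure_le[unfolded One_nat_def])

lemma integrable_saturated_departure: "integrable P (\<lambda>u. saturated_departure M c b (snd (snd u)) i)"
  by (rule measure_pmf.integrable_const_bound[where B = 1]) (simp_all add: saturated_departure_def solo_def)

lemma expectation_saturated:
  assumes "c \<in> {1..M}" "i \<in> {1..M}"
  shows "measure_pmf.expectation P (\<lambda>u. saturated_departure M c b (snd (snd u)) i)
    = q + of_bool b * coef i c"
proof -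
  have "measure_pmf.expectation P (\<lambda>u. saturated_departure M c b (snd (snd u)) i)
      = measure_pmf.expectation (map_pmf (snd \<circ> snd) P) (\<lambda>\<alpha>. saturated_departure M c b \<alpha> i)"
    by simp
  then show ?thesis
    unfolding map_pmf_mac_input using assms p
    by (subst (asm) expectation_saturated_departure) (auto simp: coef_def q_def q'_def)
qed

lemma integrable_jump_bound: "integrable P jump_bound"
  unfolding jump_bound_def
  by (intro Bochner_Integration.integrable_add Bochner_Integration.integrable_sum
      integrable_red_input integrable_green_input) auto

lemma jump_bound_nonneg: "0 \<le> jump_bound u"
  by (auto simp: jump_bound_def intro!: sum_nonneg add_nonneg_nonneg)

text \<open>The last term comes from the red departure at \<open>c\<close>. It equals the change of
  the saturated service probability of station \<open>i\<close> caused by that transmission, so the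
  two cancel in the mean.\<close>

lemma Z_step:
  assumes "c \<in> {1..M}"
  shows "Z (mac_step M c u x) i = Z x i + real (fst (snd u) i) - real (departure c x u i)
    - (\<Sum>j\<in>{1..M}. coef i j * real (fst u j)) + coef i c * of_bool (fst x c > 0)"
proof -
  have "(\<Sum>j\<in>{1..M}. coef i j * real (fst (mac_step M c u x) j))
      = (\<Sum>j\<in>{1..M}. coef i j * real (fst x j) + coef i j * real (fst u j)
          - (if j = c then coef i c * of_bool (fst x c > 0) else 0))"
    unfolding fst_step by (intro sum.cong) (auto simp: algebra_simps)
  also have "\<dots> = (\<Sum>j\<in>{1..M}. coef i j * real (fst x j)) + (\<Sum>j\<in>{1..M}. coef i j * real (fst u j))
      - coef i c * of_bool (fst x c > 0)"
    unfolding sum.distrib sum_subtractf using assms by simp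
  finally show ?thesis
    unfolding Z_def snd_step by simp
qed

lemma Z_jump:
  assumes "i \<in> {1..M}" "c \<in> {1..M}"
  shows "\<bar>Z (mac_step M c u x) i - Z x i\<bar> \<le> jump_bound u"
proof -
  have "\<bar>\<Sum>j\<in>{1..M}. coef i j * real (fst u j)\<bar> \<le> (\<Sum>j\<in>{1..M}. real (fst u j))"
    using coef_bound by (intro order_trans[OF sum_abs] sum_mono) (auto simp: abs_mult intro: mult_left_le_one_le)
  moreover have "\<bar>coef i c * of_bool (fst x c > 0)\<bar> \<le> 1"
    using coef_bound[of i c] by auto
  moreover have "real (fst (snd u) i) \<le> (\<Sum>j\<in>{1..M}. real (fst (snd u) j))"
    using assms by (intro member_le_sum) auto
  moreover have "real (departure c x u i) \<le> 1"
    using green_departure_le(1) by (metis of_nat_1 of_nat_le_iff)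
  moreover have "0 \<le> (\<Sum>j\<in>{1..M}. real (fst u j))" "0 \<le> real (fst (snd u) i)"
    "0 \<le> real (departure c x u i)"
    by (auto intro!: sum_nonneg)
  ultimately show ?thesis
    unfolding Z_step[OF assms(2)] jump_bound_def sum.distrib by linarith
qed

text \<open>The bracket compares the mean departure with its saturated value and is the only
  state-dependent part of the drift; it is zero under saturation and non-positive if buffer
  \<open>i\<close> is non-empty.\<close>

lemma
  assumes "i \<in> {1..M}" "c \<in> {1..M}"
  shows integrable_Z: "integrable P (\<lambda>u. Z (mac_step M c u x) i)"
    and expectation_Z: "measure_pmf.expectation P (\<lambda>u. Z (mac_step M c u x) i) - Z x i
      = (green_rate - capacity) / real M
        + (q + of_bool (fst x c > 0) * coef i c - measure_pmf.expectation P (\<lambda>u. real (departure c x u i)))"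
proof -
  note Z = Z_step[OF assms(2), where x = x and i = i]
  have int: "integrable P (\<lambda>u. \<Sum>j\<in>{1..M}. coef i j * real (fst u j))"
    by (intro Bochner_Integration.integrable_sum Bochner_Integration.integrable_mult_right
        integrable_red_input)
  then show "integrable P (\<lambda>u. Z (mac_step M c u x) i)"
    unfolding Z using integrable_green_input[OF assms(1)] integrable_departure
    by (intro Bochner_Integration.integrable_add Bochner_Integration.integrable_diff) auto
  have "measure_pmf.expectation P (\<lambda>u. \<Sum>j\<in>{1..M}. coef i j * real (fst u j))
      = (\<Sum>j\<in>{1..M}. coef i j * (red_rate / real M))"
    by (subst Bochner_Integration.integral_sum)
       (auto simp: integrable_red_input expectation_red_input intro!: sum.cong)
  also have "\<dots> = (\<Sum>j\<in>{1..M}. coef i j) * (red_rate / real M)"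
    by (rule sum_distrib_right[symmetric])
  finally have "measure_pmf.expectation P (\<lambda>u. Z (mac_step M c u x) i) - Z x i
      = green_rate / real M - measure_pmf.expectation P (\<lambda>u. real (departure c x u i))
        - (\<Sum>j\<in>{1..M}. coef i j) * (red_rate / real M) + coef i c * of_bool (fst x c > 0)"
    unfolding Z using int integrable_green_input[OF assms(1)] integrable_departure expectation_green_input[OF assms(1)]
    by simp
  moreover have "(green_rate - capacity) / real M
      = green_rate / real M - ((real M - 1) * q' - real M * q) * (red_rate / real M) - q"
    using M by (simp add: capacity_def field_simps)
  ultimately show "measure_pmf.expectation P (\<lambda>u. Z (mac_step M c u x) i) - Z x i
      = (green_rate - capacity) / real M
        + (q + of_bool (fst x c > 0) * coef i c - measure_pmf.expectation P (\<lambda>u. real (departure c x u i)))"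
    unfolding sum_coef[OF assms(1)] by simp
qed

lemma Z_drift_saturated:
  assumes "i \<in> {1..M}" "c \<in> {1..M}" "\<And>j. j \<in> {1..M} \<Longrightarrow> snd x j > 0"
  shows "measure_pmf.expectation P (\<lambda>u. Z (mac_step M c u x) i) - Z x i = (green_rate - capacity) / real M"
proof -
  have "(\<lambda>u. real (departure c x u i)) = (\<lambda>u. saturated_departure M c (fst x c > 0) (snd (snd u)) i)"
    using assms by (intro ext saturated_departure_eq) auto
  then show ?thesis
    unfolding expectation_Z[OF assms(1,2)] using expectation_saturated[OF assms(2,1)] by simp
qed

lemma Z_drift_nonempty:
  assumes "i \<in> {1..M}" "c \<in> {1..M}" "snd x i > 0"
  shows "measure_pmf.expectation P (\<lambda>u. Z (mac_step M c u x) i) - Z x i \<le> (green_rate - capacity) / real M"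
proof -
  have "measure_pmf.expectation P (\<lambda>u. saturated_departure M c (fst x c > 0) (snd (snd u)) i)
      \<le> measure_pmf.expectation P (\<lambda>u. real (departure c x u i))"
    using assms saturated_departure_le
    by (intro integral_mono integrable_departure integrable_saturated_departure) auto
  then show ?thesis
    unfolding expectation_Z[OF assms(1,2)] expectation_saturated[OF assms(2,1)] by simp
qed

text \<open>A crude bound for stations with an empty green buffer; the 2 dominates \<open>q\<close>
  plus a coefficient.\<close>

lemma Z_drift_upper:
  assumes "i \<in> {1..M}" "c \<in> {1..M}"
  shows "measure_pmf.expectation P (\<lambda>u. Z (mac_step M c u x) i) - Z x i
    \<le> \<bar>green_rate - capacity\<bar> + 2"
proof -
  have "(green_rate - capacity) / real M \<le> \<bar>green_rate - capacity\<bar> / real M"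
    by (intro divide_right_mono) auto
  also have "\<dots> \<le> \<bar>green_rate - capacity\<bar> / 1"
    using M by (intro divide_left_mono) auto
  finally have "(green_rate - capacity) / real M \<le> \<bar>green_rate - capacity\<bar>"
    by simp
  moreover have "0 \<le> measure_pmf.expectation P (\<lambda>u. real (departure c x u i))"
    by simp
  moreover have "of_bool (fst x c > 0) * coef i c \<le> 1"
    using coef_bound[of i c] by auto
  ultimately show ?thesis
    unfolding expectation_Z[OF assms(1,2)] using q_bounds by linarith
qed

section \<open>Red queues corrected by the phase of the coordinator\<close>

lemma phase_bounds: "0 \<le> phase c j" "phase c j \<le> 1"
  using M by (auto simp: phase_def divide_le_eq less_imp_le)

text \<open>The cyclic distance from the coordinator to \<open>j\<close> falls by one per slot,
  except that it jumps from \<open>0\<close> to \<open>M - 1\<close> after the turn of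
  \<open>j\<close>, which is an extra \<open>M\<close> before scaling.\<close>

lemma phase_next:
  assumes "c \<in> {1..M}" "j \<in> {1..M}"
  shows "phase (c mod M + 1) j = phase c j + (if j = c then 1 else 0) - 1 / real M"
proof -
  have aux: "real a = real b + (if X then real M else 0) - 1" if "a + 1 = b + (if X then M else 0)" for a b X
    using arg_cong[OF that, of real] by (cases X) simp_all
  have "(j + M - (c mod M + 1)) mod M + 1 = (j + M - c) mod M + (if j = c then M else 0)"
  proof -
    have *: "(j + M - d) mod M = (if d \<le> j then j - d else j + M - d)" if "d \<in> {1..M}" for d
    proof (cases "d \<le> j")
      case True
      then have "j + M - d = (j - d) + M" by simp
      then have "(j + M - d) mod M = (j - d) mod M" by simp
      then show ?thesis using True that assms by simp
    qed (use that in auto)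
    have "c mod M = (if c = M then 0 else c)"
      using assms by auto
    then show ?thesis
      using *[of c] *[of "c mod M + 1"] assms by auto
  qed
  then have "real ((j + M - (c mod M + 1)) mod M) = real ((j + M - c) mod M) + (if j = c then real M else 0) - 1"
    by (rule aux)
  then show ?thesis
    unfolding phase_def using M by (cases "j = c") (simp_all add: add_divide_distrib diff_divide_distrib)
qed

text \<open>A red departure removes 1 exactly when the phase jumps up by 1, so the periodic service
  becomes a constant loss of \<open>1 / real M\<close> per slot; the last term records a turn that
  finds the red buffer empty.\<close>

lemma W_step:
  assumes "c \<in> {1..M}" "j \<in> {1..M}"
  shows "W (c mod M + 1) (mac_step M c u x) j - W c x j
    = real (fst u j) - 1 / real M + of_bool (j = c \<and> fst x j = 0)"
  unfolding W_def fst_step phase_next[OF assms] by auto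

lemma W_jump:
  assumes "c \<in> {1..M}" "j \<in> {1..M}"
  shows "\<bar>W (c mod M + 1) (mac_step M c u x) j - W c x j\<bar> \<le> jump_bound u"
proof -
  have "real (fst u j) \<le> (\<Sum>j\<in>{1..M}. real (fst u j))"
    using assms by (intro member_le_sum) auto
  moreover have "0 \<le> (\<Sum>j\<in>{1..M}. real (fst (snd u) j))"
    by (intro sum_nonneg) auto
  moreover have "1 / real M \<le> 1" "0 \<le> 1 / real M" "0 \<le> real (fst u j)"
    "0 \<le> (of_bool (j = c \<and> fst x j = 0) :: real)" "of_bool (j = c \<and> fst x j = 0) \<le> (1 :: real)"
    using M by auto
  ultimately show ?thesis
    unfolding W_step[OF assms] jump_bound_def sum.distrib by linarith
qed

text \<open>The drift deviates from the constant only on a turn with an empty red buffer. Queue and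
  phase are then both \<open>0\<close>, so \<open>W c x j = 0\<close> and the slope factor
  vanishes.\<close>

lemma
  assumes "c \<in> {1..M}" "j \<in> {1..M}"
  shows integrable_W: "integrable P (\<lambda>u. W (c mod M + 1) (mac_step M c u x) j)"
    and W_drift: "L > 0 \<Longrightarrow> slope L (W c x j)
        * (measure_pmf.expectation P (\<lambda>u. W (c mod M + 1) (mac_step M c u x) j) - W c x j)
      = - (slope L (W c x j) * ((1 - red_rate) / real M))"
proof -
  have W: "(\<lambda>u. W (c mod M + 1) (mac_step M c u x) j)
      = (\<lambda>u. W c x j + (real (fst u j) - 1 / real M + of_bool (j = c \<and> fst x j = 0)))"
    unfolding W_step[OF assms, symmetric] by simp
  show "integrable P (\<lambda>u. W (c mod M + 1) (mac_step M c u x) j)"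
    unfolding W by (intro Bochner_Integration.integrable_add Bochner_Integration.integrable_diff
        integrable_red_input assms) auto
  have E: "measure_pmf.expectation P (\<lambda>u. W (c mod M + 1) (mac_step M c u x) j) - W c x j
      = red_rate / real M - 1 / real M + of_bool (j = c \<and> fst x j = 0)"
    unfolding W using integrable_red_input[OF assms(2)] expectation_red_input[OF assms(2)] by simp
  show "slope L (W c x j)
        * (measure_pmf.expectation P (\<lambda>u. W (c mod M + 1) (mac_step M c u x) j) - W c x j)
      = - (slope L (W c x j) * ((1 - red_rate) / real M))" if "L > 0"
  proof (cases "j = c \<and> fst x j = 0")
    case True
    then have "W c x j = 0"
      by (auto simp: W_def phase_def)
    then show ?thesis
      using that by (simp add: slope_eq_0)
  next
    case False
    then show ?thesis
      unfolding E by (simp add: algebra_simps diff_divide_distrib)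
  qed
qed

section \<open>The time-homogeneous chain of slot numbers and states\<close>

definition slot_step :: "mac_input \<Rightarrow> nat \<times> mac_state \<Rightarrow> nat \<times> mac_state" where
  "slot_step u a = (Suc (fst a), mac_step M (coordinator M (fst a)) u (snd a))"

text \<open>Slot numbers start at 1 because truncated subtraction gives slots 0 and 1 the same
  coordinator, which would break the cyclic succession.\<close>

definition slot_states :: "(nat \<times> mac_state) set" where
  "slot_states = {1..} \<times> mac_states M"

lemma coordinator_range: "coordinator M s \<in> {1..M}"
  using M by (auto simp: coordinator_def Suc_le_eq)

lemma coordinator_Suc: "s \<ge> 1 \<Longrightarrow> coordinator M (Suc s) = coordinator M s mod M + 1"
  by (cases s) (auto simp: coordinator_def mod_Suc_eq)

lemma coordinator_add:
  assumes "s \<ge> 1"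
  shows "coordinator M (coordinator M s + n) = coordinator M (s + n)"
proof -
  obtain s' where "s = Suc s'" using assms by (cases s) auto
  then show ?thesis
    by (simp add: coordinator_def mod_add_left_eq)
qed

lemma fold_slot_step: "fold slot_step (stake n \<omega>) (s, x) = (s + n, mac_chain M s x \<omega> n)"
  by (induction n) (auto simp: stake_Suc slot_step_def simp del: stake.simps(2))

lemma return_time_hitting: "return_time M s D x \<omega> = hitting slot_step (UNIV \<times> D) (s, x) \<omega>"
  by (simp add: return_time_def hitting_def fold_slot_step)

text \<open>\<open>mac_stable\<close> bounds the mean only for first slots in \<open>{1..M}\<close>;
  periodicity extends the bound to every slot number met along a path.\<close>

lemma return_time_coordinator: "s \<ge> 1 \<Longrightarrow> return_time M (coordinator M s) D x \<omega> = return_time M s D x \<omega>"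
proof -
  assume "s \<ge> 1"
  then have "mac_chain M (coordinator M s) x \<omega> n = mac_chain M s x \<omega> n" for n
    by (induction n) (auto simp: coordinator_add)
  then show ?thesis
    by (simp add: return_time_def)
qed

lemma expected_return_time:
  "(\<integral>\<^sup>+ \<omega>. ennreal_of_enat (return_time M s D x \<omega>) \<partial>mac_space M p red green)
    = occupation P slot_step (UNIV \<times> D) (s, x)"
  unfolding return_time_hitting mac_space_def by (rule nn_integral_hitting)

lemma slot_step_states:
  assumes "a \<in> slot_states" "u \<in> set_pmf P"
  shows "slot_step u a \<in> slot_states"
  using assms mac_input_support[OF M assms(2)]
  by (cases a; cases u) (auto simp: slot_states_def slot_step_def mac_states_def)

text \<open>Only red queues remain: those of other stations enter with weight
  \<open>q - q' \<le> 0\<close>, the own one with \<open>q \<le> 1\<close>. Hence a large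
  \<open>Z x i\<close> at an empty green buffer forces a long red queue at the same station.\<close>

lemma Z_empty:
  assumes "i \<in> {1..M}" "snd x i = 0"
  shows "Z x i \<le> W c x i"
proof -
  have "- (coef i j * real (fst x j)) \<le> (if j = i then real (fst x i) else 0)" for j
    using q_bounds mult_right_mono[of q 1 "real (fst x i)"] by (auto simp: coef_def)
  then have "(\<Sum>j\<in>{1..M}. - (coef i j * real (fst x j))) \<le> (\<Sum>j\<in>{1..M}. if j = i then real (fst x i) else 0)"
    by (intro sum_mono)
  then show ?thesis
    using assms phase_bounds(1)[of c i] by (simp add: Z_def W_def sum_negf)
qed

subsection \<open>Stability\<close>

definition lyapunov :: "real \<Rightarrow> real \<Rightarrow> nat \<Rightarrow> mac_state \<Rightarrow> real" where
  "lyapunov K L c x = K * (\<Sum>j\<in>{1..M}. huber L (W c x j)) + (\<Sum>i\<in>{1..M}. huber L (Z x i))"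

lemma lyapunov_nonneg: "K \<ge> 0 \<Longrightarrow> L > 0 \<Longrightarrow> 0 \<le> lyapunov K L c x"
  unfolding lyapunov_def by (intro add_nonneg_nonneg mult_nonneg_nonneg sum_nonneg huber_nonneg) auto

text \<open>At an empty green buffer, \<open>Z_empty\<close> orders the slopes, so the upward drift
  of \<open>Z x i\<close> costs at most \<open>C + \<epsilon>\<close> per unit of red slope, even
  after claiming the gain \<open>\<epsilon> * slope L (Z x i)\<close>. The choice of
  \<open>K\<close> supplies \<open>C + 2 * \<epsilon>\<close>, which leaves
  \<open>\<epsilon>\<close> as gain on the red slope too.\<close>

lemma
  fixes L K c x
  defines "e \<equiv> measure_pmf.expectation P (\<lambda>u. min (jump_bound u) ((jump_bound u)\<^sup>2 / L))"
    and "\<epsilon> \<equiv> (capacity - green_rate) / real M"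
  assumes c: "c \<in> {1..M}" and L: "L > 0" and K: "K \<ge> 0"
    and stable: "green_rate < capacity"
    and K': "K * ((1 - red_rate) / real M) = \<bar>green_rate - capacity\<bar> + 2 + 2 * \<epsilon>"
  shows integrable_lyapunov: "integrable P (\<lambda>u. lyapunov K L (c mod M + 1) (mac_step M c u x))"
    and lyapunov_drift: "measure_pmf.expectation P (\<lambda>u. lyapunov K L (c mod M + 1) (mac_step M c u x))
      \<le> lyapunov K L c x - \<epsilon> * (\<Sum>i\<in>{1..M}. slope L (W c x i) + slope L (Z x i)) + (K + 1) * real M * e"
proof -
  let ?E = "measure_pmf.expectation P" and ?c' = "c mod M + 1"
  define C where "C = \<bar>green_rate - capacity\<bar> + 2"
  have "\<epsilon> > 0"
    using stable M by (simp add: \<epsilon>_def)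
  have W: "integrable P (\<lambda>u. huber L (W ?c' (mac_step M c u x) j))"
    "?E (\<lambda>u. huber L (W ?c' (mac_step M c u x) j))
      \<le> huber L (W c x j) - slope L (W c x j) * ((1 - red_rate) / real M) + e" if "j \<in> {1..M}" for j
    using huber_expectation[OF L integrable_jump_bound integrable_W[OF c that] W_jump[OF c that]]
    unfolding W_drift[OF c that L] e_def by auto
  have Z: "integrable P (\<lambda>u. huber L (Z (mac_step M c u x) i))"
    "?E (\<lambda>u. huber L (Z (mac_step M c u x) i))
      \<le> huber L (Z x i) + ((C + \<epsilon>) * slope L (W c x i) - \<epsilon> * slope L (Z x i)) + e" if i: "i \<in> {1..M}" for i
  proof -
    let ?d = "?E (\<lambda>u. Z (mac_step M c u x) i) - Z x i"
    note * = huber_expectation[OF L integrable_jump_bound integrable_Z[OF i c] Z_jump[OF i c]]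
    show "integrable P (\<lambda>u. huber L (Z (mac_step M c u x) i))"
      by (rule *(1))
    have "slope L (Z x i) * ?d \<le> (C + \<epsilon>) * slope L (W c x i) - \<epsilon> * slope L (Z x i)"
    proof (cases "snd x i > 0")
      case True
      then have "?d \<le> - \<epsilon>"
        using Z_drift_nonempty[OF i c, of x] by (simp add: \<epsilon>_def minus_divide_left)
      then have "slope L (Z x i) * ?d \<le> slope L (Z x i) * (- \<epsilon>)"
        using slope_bounds by (intro mult_left_mono)
      moreover have "0 \<le> (C + \<epsilon>) * slope L (W c x i)"
        using slope_bounds \<open>\<epsilon> > 0\<close> by (auto simp: C_def)
      ultimately show ?thesis by (simp add: algebra_simps)
    next
      case False
      then have "slope L (Z x i) \<le> slope L (W c x i)"
        using Z_empty[OF i] by (intro slope_mono L) auto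
      then have "(C + \<epsilon>) * slope L (Z x i) \<le> (C + \<epsilon>) * slope L (W c x i)"
        using \<open>\<epsilon> > 0\<close> by (intro mult_left_mono) (auto simp: C_def)
      moreover have "slope L (Z x i) * ?d \<le> slope L (Z x i) * C"
        using Z_drift_upper[OF i c, of x] slope_bounds by (intro mult_left_mono) (auto simp: C_def)
      ultimately show ?thesis by (simp add: algebra_simps)
    qed
    then show "?E (\<lambda>u. huber L (Z (mac_step M c u x) i))
      \<le> huber L (Z x i) + ((C + \<epsilon>) * slope L (W c x i) - \<epsilon> * slope L (Z x i)) + e"
      using *(2)[of x] unfolding e_def by linarith
  qed
  show "integrable P (\<lambda>u. lyapunov K L ?c' (mac_step M c u x))"
    unfolding lyapunov_def
    by (intro Bochner_Integration.integrable_add Bochner_Integration.integrable_mult_right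
        Bochner_Integration.integrable_sum W Z)
  have "?E (\<lambda>u. lyapunov K L ?c' (mac_step M c u x))
      = K * (\<Sum>j\<in>{1..M}. ?E (\<lambda>u. huber L (W ?c' (mac_step M c u x) j)))
        + (\<Sum>i\<in>{1..M}. ?E (\<lambda>u. huber L (Z (mac_step M c u x) i)))"
    unfolding lyapunov_def using W(1) Z(1)
    by (subst Bochner_Integration.integral_add)
       (auto simp: Bochner_Integration.integral_sum intro!: Bochner_Integration.integrable_mult_right Bochner_Integration.integrable_sum)
  also have "\<dots> \<le> K * (\<Sum>j\<in>{1..M}. huber L (W c x j) - slope L (W c x j) * ((1 - red_rate) / real M) + e)
        + (\<Sum>i\<in>{1..M}. huber L (Z x i) + ((C + \<epsilon>) * slope L (W c x i) - \<epsilon> * slope L (Z x i)) + e)"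
    using K W(2) Z(2) by (intro add_mono mult_left_mono sum_mono) auto
  also have "\<dots> = lyapunov K L c x - K * ((1 - red_rate) / real M) * (\<Sum>i\<in>{1..M}. slope L (W c x i))
      + (C + \<epsilon>) * (\<Sum>i\<in>{1..M}. slope L (W c x i)) - \<epsilon> * (\<Sum>i\<in>{1..M}. slope L (Z x i)) + (K + 1) * real M * e"
    unfolding lyapunov_def sum.distrib sum_subtractf sum_distrib_left[symmetric] sum_distrib_right[symmetric]
    by (simp add: algebra_simps)
  also have "\<dots> = lyapunov K L c x - \<epsilon> * (\<Sum>i\<in>{1..M}. slope L (W c x i) + slope L (Z x i)) + (K + 1) * real M * e"
    unfolding K' C_def[symmetric] sum.distrib by (simp add: algebra_simps)
  finally show "?E (\<lambda>u. lyapunov K L ?c' (mac_step M c u x))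
      \<le> lyapunov K L c x - \<epsilon> * (\<Sum>i\<in>{1..M}. slope L (W c x i) + slope L (Z x i)) + (K + 1) * real M * e" .
qed

text \<open>Upper bounds suffice: once the red queues are at most \<open>L\<close>, their weighted
  sum is at most \<open>real M * \<bar>L\<bar>\<close>, and a bound on \<open>Z x i\<close> becomes
  one on the green queue.\<close>

lemma finite_bounded_states:
  "finite {x \<in> mac_states M. \<forall>i\<in>{1..M}. real (fst x i) \<le> L \<and> Z x i \<le> L}"
proof -
  define N where "N = nat \<lceil>L + real M * \<bar>L\<bar>\<rceil>"
  let ?B = "{f. \<forall>i. (i \<in> {1..M} \<longrightarrow> f i \<in> {..N}) \<and> (i \<notin> {1..M} \<longrightarrow> f i = 0)}"
  have "{x \<in> mac_states M. \<forall>i\<in>{1..M}. real (fst x i) \<le> L \<and> Z x i \<le> L} \<subseteq> ?B \<times> ?B"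
  proof
    fix x assume "x \<in> {x \<in> mac_states M. \<forall>i\<in>{1..M}. real (fst x i) \<le> L \<and> Z x i \<le> L}"
    then have x: "x \<in> mac_states M" and le: "\<And>i. i \<in> {1..M} \<Longrightarrow> real (fst x i) \<le> L" "\<And>i. i \<in> {1..M} \<Longrightarrow> Z x i \<le> L"
      by auto
    have R: "fst x i \<le> N" and G: "snd x i \<le> N" if i: "i \<in> {1..M}" for i
    proof -
      have "coef i j * real (fst x j) \<le> \<bar>L\<bar>" if "j \<in> {1..M}" for j
      proof -
        have "coef i j * real (fst x j) \<le> 1 * real (fst x j)"
          using coef_bound[of i j] by (intro mult_right_mono) auto
        then show ?thesis using le(1)[OF that] by simp
      qed
      then have "(\<Sum>j\<in>{1..M}. coef i j * real (fst x j)) \<le> (\<Sum>j\<in>{1..M}. \<bar>L\<bar>)"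
        by (intro sum_mono)
      then have "real (snd x i) \<le> L + real M * \<bar>L\<bar>"
        using le(2)[OF i] by (simp add: Z_def)
      then show "snd x i \<le> N"
        unfolding N_def by linarith
      have "0 \<le> real M * \<bar>L\<bar>" by simp
      then have "real (fst x i) \<le> L + real M * \<bar>L\<bar>"
        using le(1)[OF i] by linarith
      then show "fst x i \<le> N"
        unfolding N_def by linarith
    qed
    show "x \<in> ?B \<times> ?B"
      using x R G by (cases x) (auto simp: mac_states_def)
  qed
  moreover have "finite ?B"
    by (intro finite_set_of_finite_funs) auto
  ultimately show ?thesis
    by (meson finite_SigmaI finite_subset)
qed

lemma le_divide_ennreal:
  assumes "ennreal d * X \<le> ennreal y" "d > 0" "y \<ge> 0"
  shows "X \<le> ennreal (y / d)"
proof (cases X)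
  case (real r)
  then have "ennreal (d * r) \<le> ennreal y"
    using assms by (simp add: ennreal_mult)
  then have "d * r \<le> y"
    using assms real by (simp add: ennreal_le_iff)
  then show ?thesis
    using assms real by (simp add: field_simps)
next
  case top
  then show ?thesis
    using assms by (simp add: ennreal_mult_top top_unique)
qed

theorem stable:
  assumes red: "red_rate < 1" and green: "green_rate < capacity"
  shows "mac_stable M p red green"
proof -
  define \<epsilon> where "\<epsilon> = (capacity - green_rate) / real M"
  define K where "K = (\<bar>green_rate - capacity\<bar> + 2 + 2 * \<epsilon>) / ((1 - red_rate) / real M)"
  have \<epsilon>: "\<epsilon> > 0"
    using green M by (simp add: \<epsilon>_def)
  have K: "K \<ge> 0"
    using red \<epsilon> M by (simp add: K_def)
  have K': "K * ((1 - red_rate) / real M) = \<bar>green_rate - capacity\<bar> + 2 + 2 * \<epsilon>"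
    using red M by (simp add: K_def)
  \<comment> \<open>There are \<open>M\<close> red terms of weight \<open>K\<close> and
    \<open>M\<close> green terms of weight 1, each with the same error; half of the drift
    \<open>\<epsilon>\<close> is reserved for them. \<open>K\<close> does not depend on
    \<open>L\<close>, so \<open>L\<close> can be chosen last.\<close>
  have "\<epsilon> / 2 / ((K + 1) * real M) > 0"
    using \<epsilon> K M by simp
  then obtain L where L: "L \<ge> 1"
    and e: "measure_pmf.expectation P (\<lambda>u. min (jump_bound u) ((jump_bound u)\<^sup>2 / L)) < \<epsilon> / 2 / ((K + 1) * real M)"
      (is "?e < _")
    by (rule small_error[OF integrable_jump_bound jump_bound_nonneg])
  have "(K + 1) * real M * ?e \<le> (K + 1) * real M * (\<epsilon> / 2 / ((K + 1) * real M))"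
    using e K M by (intro mult_left_mono) auto
  also have "\<dots> = \<epsilon> / 2"
    using K M by simp
  finally have e: "(K + 1) * real M * ?e \<le> \<epsilon> / 2" .
  define D where "D = {x \<in> mac_states M. \<forall>i\<in>{1..M}. real (fst x i) \<le> L \<and> Z x i \<le> L}"
  define v where "v a = lyapunov K L (coordinator M (fst a)) (snd a)" for a
  have v: "0 \<le> v a" for a
    unfolding v_def using K L by (intro lyapunov_nonneg) auto
  have drift: "0 \<le> v a - \<epsilon> * (\<Sum>i\<in>{1..M}. slope L (W (coordinator M (fst a)) (snd a) i) + slope L (Z (snd a) i)) + \<epsilon> / 2"
    "killed P slot_step (UNIV \<times> D) (\<lambda>a. ennreal (v a)) a
      \<le> ennreal (v a - \<epsilon> * (\<Sum>i\<in>{1..M}. slope L (W (coordinator M (fst a)) (snd a) i) + slope L (Z (snd a) i)) + \<epsilon> / 2)"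
    if "a \<in> slot_states" for a
  proof -
    let ?c = "coordinator M (fst a)"
    note lya = integrable_lyapunov[OF coordinator_range _ K green K'[unfolded \<epsilon>_def], of L "fst a" "snd a"]
      lyapunov_drift[OF coordinator_range _ K green K'[unfolded \<epsilon>_def], of L "fst a" "snd a"]
    have step: "v (slot_step u a) = lyapunov K L (?c mod M + 1) (mac_step M ?c u (snd a))" for u
      using that by (simp add: v_def slot_step_def coordinator_Suc slot_states_def mem_Times_iff)
    have le: "measure_pmf.expectation P (\<lambda>u. v (slot_step u a))
        \<le> v a - \<epsilon> * (\<Sum>i\<in>{1..M}. slope L (W ?c (snd a) i) + slope L (Z (snd a) i)) + \<epsilon> / 2"
      unfolding step using lya(2) L e by (simp add: v_def \<epsilon>_def)
    moreover have "0 \<le> measure_pmf.expectation P (\<lambda>u. v (slot_step u a))"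
      using v by simp
    ultimately show "0 \<le> v a - \<epsilon> * (\<Sum>i\<in>{1..M}. slope L (W ?c (snd a) i) + slope L (Z (snd a) i)) + \<epsilon> / 2"
      by linarith
    have "killed P slot_step (UNIV \<times> D) (\<lambda>a. ennreal (v a)) a \<le> (\<integral>\<^sup>+ u. ennreal (v (slot_step u a)) \<partial>measure_pmf P)"
      unfolding killed_def by (intro nn_integral_mono) auto
    also have "\<dots> = ennreal (measure_pmf.expectation P (\<lambda>u. v (slot_step u a)))"
      unfolding step using lya(1) L K lyapunov_nonneg[of K L] by (intro nn_integral_eq_integral) auto
    also have "\<dots> \<le> ennreal (v a - \<epsilon> * (\<Sum>i\<in>{1..M}. slope L (W ?c (snd a) i) + slope L (Z (snd a) i)) + \<epsilon> / 2)"
      using le by (rule ennreal_leI)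
    finally show "killed P slot_step (UNIV \<times> D) (\<lambda>a. ennreal (v a)) a
      \<le> ennreal (v a - \<epsilon> * (\<Sum>i\<in>{1..M}. slope L (W ?c (snd a) i) + slope L (Z (snd a) i)) + \<epsilon> / 2)" .
  qed
  have slopes: "0 \<le> (\<Sum>i\<in>{1..M}. slope L (W c x i) + slope L (Z x i))" for c x
    by (intro sum_nonneg add_nonneg_nonneg slope_bounds)
  \<comment> \<open>Outside \<open>D\<close> some Huber function is in its linear range; in the red
    case because \<open>W\<close> dominates the red queue.\<close>
  have far: "1 \<le> (\<Sum>i\<in>{1..M}. slope L (W c x i) + slope L (Z x i))" if x: "x \<in> mac_states M" "x \<notin> D" for c x
  proof -
    obtain i where i: "i \<in> {1..M}" "real (fst x i) > L \<or> Z x i > L"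
      using x by (force simp: D_def)
    have "slope L (W c x i) = 1 \<or> slope L (Z x i) = 1"
      using i(2) L phase_bounds(1)[of c i] by (auto simp: W_def intro!: slope_eq_1)
    then have "1 \<le> slope L (W c x i) + slope L (Z x i)"
      using slope_bounds(1) by (auto simp: add_increasing add_increasing2)
    also have "\<dots> \<le> (\<Sum>i\<in>{1..M}. slope L (W c x i) + slope L (Z x i))"
      using i(1) by (intro member_le_sum) (auto intro!: add_nonneg_nonneg slope_bounds)
    finally show ?thesis .
  qed
  have bound: "occupation P slot_step (UNIV \<times> D) a \<le> ennreal ((v a + \<epsilon>) / (\<epsilon> / 2))" if "a \<in> slot_states" for a
  proof (rule le_divide_ennreal)
    have "ennreal (\<epsilon> / 2) * occupation P slot_step (UNIV \<times> D) a \<le> ennreal (v a) + ennreal \<epsilon>"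
    proof (rule foster[OF slot_step_states])
      fix a assume a: "a \<in> slot_states"
      let ?s = "\<Sum>i\<in>{1..M}. slope L (W (coordinator M (fst a)) (snd a) i) + slope L (Z (snd a) i)"
      have "killed P slot_step (UNIV \<times> D) (\<lambda>a. ennreal (v a)) a + ennreal (\<epsilon> / 2)
          \<le> ennreal (v a - \<epsilon> * ?s + \<epsilon> / 2) + ennreal (\<epsilon> / 2)"
        using drift(2)[OF a] by (rule add_right_mono)
      also have "\<dots> = ennreal (v a + \<epsilon> - \<epsilon> * ?s)"
        using \<epsilon> drift(1)[OF a] by (subst ennreal_plus[symmetric]) (auto simp: algebra_simps)
      finally have *: "killed P slot_step (UNIV \<times> D) (\<lambda>a. ennreal (v a)) a + ennreal (\<epsilon> / 2)
          \<le> ennreal (v a + \<epsilon> - \<epsilon> * ?s)" .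
      have "0 \<le> \<epsilon> * ?s"
        using slopes \<epsilon> by (intro mult_nonneg_nonneg) auto
      then have "ennreal (v a + \<epsilon> - \<epsilon> * ?s) \<le> ennreal (v a + \<epsilon>)"
        by (intro ennreal_leI) simp
      also have "\<dots> = ennreal (v a) + ennreal \<epsilon>"
        using v[of a] \<epsilon> by (intro ennreal_plus) auto
      finally show "killed P slot_step (UNIV \<times> D) (\<lambda>a. ennreal (v a)) a + ennreal (\<epsilon> / 2) \<le> ennreal (v a) + ennreal \<epsilon>"
        by (rule order_trans[OF *])
      show "killed P slot_step (UNIV \<times> D) (\<lambda>a. ennreal (v a)) a + ennreal (\<epsilon> / 2) \<le> ennreal (v a)"
        if "a \<notin> UNIV \<times> D"
      proof -
        have "1 \<le> ?s"
          using a that by (intro far) (auto simp: slot_states_def mem_Times_iff)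
        then have "v a + \<epsilon> - \<epsilon> * ?s \<le> v a"
          using \<epsilon> mult_left_mono[of 1 ?s \<epsilon>] by simp
        then show ?thesis
          by (intro order_trans[OF *] ennreal_leI)
      qed
    qed (use that in auto)
    then show "ennreal (\<epsilon> / 2) * occupation P slot_step (UNIV \<times> D) a \<le> ennreal (v a + \<epsilon>)"
      using v[of a] \<epsilon> by (simp add: ennreal_plus)
  qed (use \<epsilon> v in auto)
  show ?thesis
    unfolding mac_stable_def
  proof (intro exI conjI ballI)
    show "finite D" "D \<subseteq> mac_states M"
      using finite_bounded_states by (auto simp: D_def)
    fix s assume s: "s \<in> {1..M}"
    show "AE \<omega> in mac_space M p red green. return_time M s D x \<omega> < \<infinity>" if "x \<in> mac_states M" for x
      unfolding return_time_hitting mac_space_def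
      using bound[of "(s, x)"] that s by (intro AE_hitting_finite) (auto simp: slot_states_def intro: le_less_trans)
    fix x assume x: "x \<in> D"
    have "(v (s, x) + \<epsilon>) / (\<epsilon> / 2) \<le> (\<Sum>a\<in>{1..M} \<times> D. (v a + \<epsilon>) / (\<epsilon> / 2))"
      using x s v \<epsilon> \<open>finite D\<close> by (intro member_le_sum) auto
    then show "(\<integral>\<^sup>+ \<omega>. ennreal_of_enat (return_time M s D x \<omega>) \<partial>mac_space M p red green)
        \<le> ennreal (\<Sum>a\<in>{1..M} \<times> D. (v a + \<epsilon>) / (\<epsilon> / 2))"
      unfolding expected_return_time using x s \<open>D \<subseteq> mac_states M\<close>
      by (intro order_trans[OF bound] ennreal_leI) (auto simp: slot_states_def)
  qed
qed

subsection \<open>Instability\<close>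

definition mean_Z :: "mac_state \<Rightarrow> real" where
  "mean_Z x = (\<Sum>i\<in>{1..M}. Z x i) / real M"

text \<open>The potential is at most \<open>L\<close> as soon as one green buffer is empty, so that above
  \<open>L\<close> the drifts of all \<open>Z x i\<close> coincide.\<close>

definition potential :: "real \<Rightarrow> nat \<Rightarrow> mac_state \<Rightarrow> real" where
  "potential L c x = mean_Z x - (\<Sum>i\<in>{1..M}. huber L (mean_Z x - Z x i)) - (\<Sum>j\<in>{1..M}. huber L (W c x j))"

text \<open>Keep only the two penalties of station \<open>i\<close>, each at least its argument
  minus \<open>L / 2\<close>. The means cancel and \<open>Z x i - W c x i + L\<close> remains, with
  a non-positive difference by \<open>Z_empty\<close>.\<close>

lemma potential_le:
  assumes "L > 0" "i \<in> {1..M}" "snd x i = 0"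
  shows "potential L c x \<le> L"
proof -
  have "mean_Z x - Z x i - L / 2 \<le> huber L (mean_Z x - Z x i)"
    using huber_ge_linear[OF assms(1)] by auto
  also have "\<dots> \<le> (\<Sum>i\<in>{1..M}. huber L (mean_Z x - Z x i))"
    using assms by (intro member_le_sum) (auto intro: huber_nonneg)
  finally have "mean_Z x - Z x i - L / 2 \<le> (\<Sum>i\<in>{1..M}. huber L (mean_Z x - Z x i))" .
  moreover have "W c x i - L / 2 \<le> huber L (W c x i)"
    using huber_ge_linear[OF assms(1)] by auto
  then have "W c x i - L / 2 \<le> (\<Sum>j\<in>{1..M}. huber L (W c x j))"
    using assms by (intro order_trans[OF _ member_le_sum[of i]]) (auto intro: huber_nonneg)
  ultimately show ?thesis
    using Z_empty[OF assms(2,3), of c] by (simp add: potential_def)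
qed

lemma mean_Z_jump:
  assumes "c \<in> {1..M}"
  shows "\<bar>mean_Z (mac_step M c u x) - mean_Z x\<bar> \<le> jump_bound u"
proof -
  have "\<bar>\<Sum>i\<in>{1..M}. Z (mac_step M c u x) i - Z x i\<bar> \<le> (\<Sum>i\<in>{1..M}. jump_bound u)"
    using Z_jump assms by (intro order_trans[OF sum_abs] sum_mono) auto
  also have "\<dots> = real M * jump_bound u"
    by simp
  finally show ?thesis
    using M by (simp add: mean_Z_def diff_divide_distrib[symmetric] sum_subtractf abs_divide divide_le_eq mult.commute)
qed

lemma deviation_jump:
  assumes "c \<in> {1..M}" "i \<in> {1..M}"
  shows "\<bar>(mean_Z (mac_step M c u x) - Z (mac_step M c u x) i) - (mean_Z x - Z x i)\<bar> \<le> 2 * jump_bound u"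
  using mean_Z_jump[OF assms(1), of u x] Z_jump[OF assms(2,1), of u x] by linarith

text \<open>Huber functions are 1-Lipschitz, so the jumps add up: one for the mean, two for each of
  the \<open>M\<close> deviations, one for each of the \<open>M\<close> red terms.\<close>

lemma potential_jump:
  assumes "L > 0" "c \<in> {1..M}"
  shows "\<bar>potential L (c mod M + 1) (mac_step M c u x) - potential L c x\<bar> \<le> (3 * real M + 1) * jump_bound u"
proof -
  let ?c' = "c mod M + 1" and ?x' = "mac_step M c u x"
  have "\<bar>\<Sum>i\<in>{1..M}. huber L (mean_Z ?x' - Z ?x' i) - huber L (mean_Z x - Z x i)\<bar>
      \<le> (\<Sum>i\<in>{1..M}. 2 * jump_bound u)"
    using deviation_jump[OF assms(2)] huber_lipschitz[OF assms(1)]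
    by (intro order_trans[OF sum_abs] sum_mono) (blast intro: order_trans)
  moreover have "\<bar>\<Sum>i\<in>{1..M}. huber L (W ?c' ?x' i) - huber L (W c x i)\<bar> \<le> (\<Sum>i\<in>{1..M}. jump_bound u)"
    using W_jump[OF assms(2)] huber_lipschitz[OF assms(1)]
    by (intro order_trans[OF sum_abs] sum_mono) (blast intro: order_trans)
  ultimately show ?thesis
    using mean_Z_jump[OF assms(2), of u x]
    unfolding potential_def sum_subtractf by (simp add: algebra_simps abs_le_iff)
qed

lemma
  assumes "c \<in> {1..M}"
  shows integrable_mean_Z: "integrable P (\<lambda>u. mean_Z (mac_step M c u x))"
    and mean_Z_drift: "(\<And>j. j \<in> {1..M} \<Longrightarrow> snd x j > 0) \<Longrightarrow>
      measure_pmf.expectation P (\<lambda>u. mean_Z (mac_step M c u x)) = mean_Z x + (green_rate - capacity) / real M"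
proof -
  show "integrable P (\<lambda>u. mean_Z (mac_step M c u x))"
    unfolding mean_Z_def
    by (intro Bochner_Integration.integrable_divide_zero Bochner_Integration.integrable_sum integrable_Z assms)
  assume "\<And>j. j \<in> {1..M} \<Longrightarrow> snd x j > 0"
  then have "measure_pmf.expectation P (\<lambda>u. Z (mac_step M c u x) i) = Z x i + (green_rate - capacity) / real M"
    if "i \<in> {1..M}" for i
    using Z_drift_saturated[OF that assms, of x] by simp
  then have "(\<Sum>i\<in>{1..M}. measure_pmf.expectation P (\<lambda>u. Z (mac_step M c u x) i))
      = (\<Sum>i\<in>{1..M}. Z x i) + real M * ((green_rate - capacity) / real M)"
    by (simp add: sum.distrib)
  moreover have "measure_pmf.expectation P (\<lambda>u. mean_Z (mac_step M c u x))
      = (\<Sum>i\<in>{1..M}. measure_pmf.expectation P (\<lambda>u. Z (mac_step M c u x) i)) / real M"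
    unfolding mean_Z_def using integrable_Z assms by (simp add: Bochner_Integration.integral_sum)
  ultimately show "measure_pmf.expectation P (\<lambda>u. mean_Z (mac_step M c u x))
      = mean_Z x + (green_rate - capacity) / real M"
    using M by (simp add: mean_Z_def add_divide_distrib)
qed

text \<open>Under saturation the deviations from the mean have zero drift, and the first-order
  change of the red penalties is non-positive, so the \<open>2 * M\<close> subtracted terms cost
  only their second-order errors.\<close>

lemma
  fixes L c x
  defines "e \<equiv> measure_pmf.expectation P (\<lambda>u. min (2 * jump_bound u) ((2 * jump_bound u)\<^sup>2 / L))"
  assumes c: "c \<in> {1..M}" and L: "L > 0" and red: "red_rate \<le> 1"
  shows integrable_potential: "integrable P (\<lambda>u. potential L (c mod M + 1) (mac_step M c u x))"
    and potential_drift: "(\<And>j. j \<in> {1..M} \<Longrightarrow> snd x j > 0) \<Longrightarrow>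
      measure_pmf.expectation P (\<lambda>u. potential L (c mod M + 1) (mac_step M c u x))
        \<ge> potential L c x + (green_rate - capacity) / real M - 2 * real M * e"
proof -
  let ?E = "measure_pmf.expectation P" and ?c' = "c mod M + 1" and ?x' = "\<lambda>u. mac_step M c u x"
  have J: "integrable P (\<lambda>u. 2 * jump_bound u)"
    using integrable_jump_bound by simp
  have W: "integrable P (\<lambda>u. huber L (W ?c' (?x' u) j))"
    "?E (\<lambda>u. huber L (W ?c' (?x' u) j)) \<le> huber L (W c x j) + e" if j: "j \<in> {1..M}" for j
  proof -
    \<comment> \<open>The doubled bound that the deviations need is used here too, so that one error
      \<open>e\<close> serves both kinds of term.\<close>
    have "\<bar>W ?c' (?x' u) j - W c x j\<bar> \<le> 2 * jump_bound u" for u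
      using W_jump[OF c j, of u x] jump_bound_nonneg[of u] by linarith
    note * = huber_expectation[OF L J integrable_W[OF c j] this]
    show "integrable P (\<lambda>u. huber L (W ?c' (?x' u) j))"
      by (rule *(1))
    have "0 \<le> slope L (W c x j) * ((1 - red_rate) / real M)"
      using red slope_bounds by auto
    then show "?E (\<lambda>u. huber L (W ?c' (?x' u) j)) \<le> huber L (W c x j) + e"
      using *(2) unfolding W_drift[OF c j L] e_def by linarith
  qed
  have int_dev: "integrable P (\<lambda>u. mean_Z (?x' u) - Z (?x' u) i)" if "i \<in> {1..M}" for i
    by (intro Bochner_Integration.integrable_diff integrable_mean_Z integrable_Z c that)
  have dev: "integrable P (\<lambda>u. huber L (mean_Z (?x' u) - Z (?x' u) i))" if i: "i \<in> {1..M}" for i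
    by (rule huber_expectation(1)[OF L J int_dev[OF i] deviation_jump[OF c i]])
  note int_sums = Bochner_Integration.integrable_sum[of "{1..M}", OF dev]
    Bochner_Integration.integrable_sum[of "{1..M}", OF W(1)]
  show "integrable P (\<lambda>u. potential L ?c' (?x' u))"
    unfolding potential_def
    by (intro Bochner_Integration.integrable_diff int_sums integrable_mean_Z c)
  assume pos: "\<And>j. j \<in> {1..M} \<Longrightarrow> snd x j > 0"
  have dev2: "?E (\<lambda>u. huber L (mean_Z (?x' u) - Z (?x' u) i)) \<le> huber L (mean_Z x - Z x i) + e" if i: "i \<in> {1..M}" for i
  proof -
    have "?E (\<lambda>u. mean_Z (?x' u) - Z (?x' u) i) - (mean_Z x - Z x i) = 0"
      using mean_Z_drift[OF c pos] Z_drift_saturated[OF i c pos]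
      by (subst Bochner_Integration.integral_diff) (auto intro: integrable_mean_Z integrable_Z c i)
    then show ?thesis
      using huber_expectation(2)[OF L J int_dev[OF i] deviation_jump[OF c i]] by (simp add: e_def)
  qed
  have mean: "?E (\<lambda>u. mean_Z (?x' u)) = mean_Z x + (green_rate - capacity) / real M"
    using mean_Z_drift[OF c] pos by blast
  have E: "?E (\<lambda>u. potential L ?c' (?x' u)) = ?E (\<lambda>u. mean_Z (?x' u))
      - (\<Sum>i\<in>{1..M}. ?E (\<lambda>u. huber L (mean_Z (?x' u) - Z (?x' u) i)))
      - (\<Sum>j\<in>{1..M}. ?E (\<lambda>u. huber L (W ?c' (?x' u) j)))"
    unfolding potential_def
    using int_sums integrable_mean_Z[OF c] dev W(1)
    by (simp add: Bochner_Integration.integral_sum Bochner_Integration.integral_diff)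
  have "(\<Sum>i\<in>{1..M}. ?E (\<lambda>u. huber L (mean_Z (?x' u) - Z (?x' u) i)))
      \<le> (\<Sum>i\<in>{1..M}. huber L (mean_Z x - Z x i)) + real M * e"
    using sum_mono[of "{1..M}", OF dev2] by (simp add: sum.distrib)
  moreover have "(\<Sum>j\<in>{1..M}. ?E (\<lambda>u. huber L (W ?c' (?x' u) j))) \<le> (\<Sum>j\<in>{1..M}. huber L (W c x j)) + real M * e"
    using sum_mono[of "{1..M}", OF W(2)] by (simp add: sum.distrib)
  ultimately show "?E (\<lambda>u. potential L ?c' (?x' u)) \<ge> potential L c x + (green_rate - capacity) / real M - 2 * real M * e"
    unfolding E mean by (simp add: potential_def algebra_simps)
qed

text \<open>Encoded by finite mean return time rather than by paths: this is what
  \<open>submartingale_vanishes\<close> requires, and it propagates along inputs of positive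
  probability.\<close>

definition reachable :: "mac_state set \<Rightarrow> (nat \<times> mac_state) set" where
  "reachable D = {a \<in> slot_states. occupation P slot_step (UNIV \<times> D) a < \<infinity>}"

text \<open>By \<open>occupation_unfold\<close> a finite mean at \<open>a\<close> is an average over
  the successors outside \<open>D\<close>, hence finite at each one of positive probability.
  Successors in \<open>D\<close>, hidden by the killing, are covered by the assumption.\<close>

lemma reachable_step:
  assumes D: "\<And>s x. s \<ge> 1 \<Longrightarrow> x \<in> D \<Longrightarrow> occupation P slot_step (UNIV \<times> D) (s, x) < \<infinity>"
    and a: "a \<in> reachable D" and u: "u \<in> set_pmf P"
  shows "slot_step u a \<in> reachable D"
proof -
  let ?N = "occupation P slot_step (UNIV \<times> D)"
  have states: "slot_step u a \<in> slot_states"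
    using a u by (auto simp: reachable_def intro: slot_step_states)
  have "killed P slot_step (UNIV \<times> D) ?N a < \<infinity>"
    using a by (auto simp: reachable_def occupation_unfold[of P slot_step "UNIV \<times> D" a] less_top)
  then have "AE u in P. (if slot_step u a \<in> UNIV \<times> D then 0 else ?N (slot_step u a)) \<noteq> \<infinity>"
    unfolding killed_def by (intro nn_integral_noteq_infinite) auto
  then have "(if slot_step u a \<in> UNIV \<times> D then 0 else ?N (slot_step u a)) \<noteq> \<infinity>"
    using u by (auto simp: AE_measure_pmf_iff)
  moreover have "?N (slot_step u a) < \<infinity>" if "slot_step u a \<in> UNIV \<times> D"
    using D[of "fst (slot_step u a)" "snd (slot_step u a)"] that states
    by (auto simp: slot_states_def mem_Times_iff)
  ultimately show ?thesis
    using states by (auto simp: reachable_def less_top split: if_splits)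
qed

text \<open>The list \<open>ks\<close> schedules silent slots, each bringing \<open>n\<close> green
  messages to the named station. The coordinator may still send red messages, hence the inequality
  for the red queues.\<close>

lemma reachable_green_growth:
  assumes D: "\<And>s x. s \<ge> 1 \<Longrightarrow> x \<in> D \<Longrightarrow> occupation P slot_step (UNIV \<times> D) (s, x) < \<infinity>"
    and zero: "0 \<in> set_pmf red" and n: "n \<in> set_pmf green"
    and "(s, x) \<in> reachable D" and "set ks \<subseteq> {1..M}"
  shows "\<exists>s' x'. (s', x') \<in> reachable D \<and> (\<forall>i. fst x' i \<le> fst x i)
    \<and> (\<forall>i. snd x' i = snd x i + n * count_list ks i)"
  using assms(4,5)
proof (induction ks arbitrary: s x)
  case Nil
  then show ?case by (intro exI[of _ s] exI[of _ x]) auto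
next
  case (Cons k ks)
  define u :: mac_input where "u = (\<lambda>_. 0, \<lambda>i. if i = k then n else 0, \<lambda>_. False)"
  define y where "y = mac_step M (coordinator M s) u x"
  have "u \<in> set_pmf P"
    unfolding u_def using M p zero n Cons.prems by (intro mac_input_witness) auto
  then have "slot_step u (s, x) \<in> reachable D"
    using Cons.prems by (intro reachable_step D)
  then have "(Suc s, y) \<in> reachable D"
    by (simp add: slot_step_def y_def)
  moreover have y: "fst y i \<le> fst x i" "snd y i = snd x i + (if i = k then n else 0)" for i
    by (cases x; simp add: y_def u_def green_departure_attempt)+
  ultimately obtain s' x' where x': "(s', x') \<in> reachable D" "\<And>i. fst x' i \<le> fst y i"
    "\<And>i. snd x' i = snd y i + n * count_list ks i"
    using Cons.IH[where s = "Suc s" and x = y] Cons.prems(2) by fastforce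
  have "fst x' i \<le> fst x i" for i
    using x'(2)[of i] y(1)[of i] by simp
  moreover have "snd x' i = snd x i + n * count_list (k # ks) i" for i
    using x'(3)[of i] y(2)[of i] by simp
  ultimately show ?case
    using x'(1) by blast
qed

text \<open>Adding equally many messages to all green buffers raises the mean, while imbalances and
  red queues, and with them the penalties, stay bounded.\<close>

lemma potential_unbounded:
  assumes D: "\<And>s x. s \<ge> 1 \<Longrightarrow> x \<in> D \<Longrightarrow> occupation P slot_step (UNIV \<times> D) (s, x) < \<infinity>"
    and zero: "0 \<in> set_pmf red" and n: "n \<in> set_pmf green" "n \<ge> 1"
    and x: "(s, x) \<in> reachable D" and L: "L > 0"
  obtains s' x' where "(s', x') \<in> reachable D" "potential L (coordinator M s') x' > k"
proof -
  define r where "r = (\<Sum>j\<in>{1..M}. real (fst x j))"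
  define g where "g = (\<Sum>j\<in>{1..M}. real (snd x j))"
  have nonneg: "0 \<le> r" "0 \<le> g"
    by (auto simp: r_def g_def intro: sum_nonneg)
  \<comment> \<open>The summands beyond \<open>k\<close> pay for the loss \<open>r\<close> in the
    mean, for deviations of at most \<open>g + 2 * r\<close> each, and for red penalties of at most
    \<open>r + 1\<close> each.\<close>
  obtain m :: nat where m: "real m > k + r + real M * (g + 2 * r) + real M * (r + 1)"
    using reals_Archimedean2 by blast
  have ks: "count_list (concat (replicate m [1..<Suc M])) i = m" if "i \<in> {1..M}" for i
  proof -
    have "count_list xs i = 1" if "distinct xs" "i \<in> set xs" for xs :: "nat list"
      using that by (induction xs) auto
    then have "count_list [1..<Suc M] i = 1"
      using that by simp
    then show ?thesis
      by (induction m) auto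
  qed
  have "set (concat (replicate m [1..<Suc M])) \<subseteq> {1..M}"
    by auto
  then obtain s' x' where x': "(s', x') \<in> reachable D" "\<And>i. fst x' i \<le> fst x i"
    "\<And>i. snd x' i = snd x i + n * count_list (concat (replicate m [1..<Suc M])) i"
    using reachable_green_growth[OF D zero n(1) x] by blast
  define h where "h = real n * real m"
  have Z: "h - r \<le> Z x' i" "Z x' i \<le> h + g + r" if i: "i \<in> {1..M}" for i
  proof -
    have "\<bar>\<Sum>j\<in>{1..M}. coef i j * real (fst x' j)\<bar> \<le> (\<Sum>j\<in>{1..M}. real (fst x j))"
    proof (intro order_trans[OF sum_abs] sum_mono)
      fix j
      have "\<bar>coef i j * real (fst x' j)\<bar> \<le> 1 * real (fst x' j)"
        unfolding abs_mult using coef_bound by (intro mult_mono) auto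
      then show "\<bar>coef i j * real (fst x' j)\<bar> \<le> real (fst x j)"
        using x'(2)[of j] by simp
    qed
    moreover have "real (snd x i) \<le> g"
      unfolding g_def using i by (intro member_le_sum) auto
    moreover have "real (snd x' i) = real (snd x i) + h"
      using x'(3)[of i] ks[OF i] by (simp add: h_def)
    ultimately show "h - r \<le> Z x' i" "Z x' i \<le> h + g + r"
      by (auto simp: Z_def r_def abs_le_iff)
  qed
  have "(\<Sum>i\<in>{1..M}. h - r) \<le> (\<Sum>i\<in>{1..M}. Z x' i)" "(\<Sum>i\<in>{1..M}. Z x' i) \<le> (\<Sum>i\<in>{1..M}. h + g + r)"
    using Z by (intro sum_mono; simp)+
  then have mean: "h - r \<le> mean_Z x'" "mean_Z x' \<le> h + g + r"
    using M by (auto simp: mean_Z_def field_simps)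
  have "(\<Sum>i\<in>{1..M}. huber L (mean_Z x' - Z x' i)) \<le> (\<Sum>i\<in>{1..M}. g + 2 * r)"
    using Z mean nonneg L by (intro sum_mono huber_le) force+
  moreover have "(\<Sum>j\<in>{1..M}. huber L (W (coordinator M s') x' j)) \<le> (\<Sum>j\<in>{1..M}. r + 1)"
  proof (intro sum_mono huber_le L)
    fix j assume j: "j \<in> {1..M}"
    have "real (fst x' j) \<le> real (fst x j)"
      using x'(2) by simp
    also have "\<dots> \<le> r"
      unfolding r_def using j by (intro member_le_sum) auto
    finally show "W (coordinator M s') x' j \<le> r + 1"
      using phase_bounds(2)[of "coordinator M s'" j] by (simp add: W_def)
  qed (use nonneg in simp)
  moreover have "real m \<le> h"
    unfolding h_def using n(2) mult_right_mono[of 1 "real n" "real m"] by simp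
  ultimately have "potential L (coordinator M s') x' > k"
    using m mean by (simp add: potential_def)
  with x'(1) show ?thesis
    by (rule that)
qed

lemma zero_red_arrivals: "red_rate < 1 \<Longrightarrow> 0 \<in> set_pmf red"
proof (rule ccontr)
  assume red: "red_rate < 1" and zero: "0 \<notin> set_pmf red"
  have "measure_pmf.expectation red (\<lambda>_. 1) \<le> measure_pmf.expectation red real"
    using integrable_red zero
    by (intro integral_mono_AE) (auto simp: AE_measure_pmf_iff Suc_le_eq intro: gr0I)
  then show False
    using red by (simp add: red_rate_def)
qed

lemma positive_green_arrivals:
  assumes "green_rate > 0"
  obtains n where "n \<in> set_pmf green" "n \<ge> 1"
proof (rule ccontr)
  assume "\<not> thesis"
  then have "AE n in green. real n = 0"
    using that by (force simp: AE_measure_pmf_iff)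
  then have "measure_pmf.expectation green real = measure_pmf.expectation green (\<lambda>_. 0)"
    by (intro integral_cong_AE) auto
  then show False
    using assms by (simp add: green_rate_def)
qed

theorem unstable:
  assumes red: "red_rate < 1" and green: "capacity < green_rate"
  shows "\<not> mac_stable M p red green"
proof
  assume "mac_stable M p red green"
  then obtain D C where D: "finite D" "D \<subseteq> mac_states M"
    and ret: "\<And>x s. x \<in> mac_states M \<Longrightarrow> s \<in> {1..M} \<Longrightarrow> AE \<omega> in mac_space M p red green. return_time M s D x \<omega> < \<infinity>"
    and C: "\<And>x s. x \<in> D \<Longrightarrow> s \<in> {1..M} \<Longrightarrow>
      (\<integral>\<^sup>+ \<omega>. ennreal_of_enat (return_time M s D x \<omega>) \<partial>mac_space M p red green) \<le> ennreal C"
    unfolding mac_stable_def by blast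
  have fin: "occupation P slot_step (UNIV \<times> D) (s, x) < \<infinity>" if "s \<ge> 1" "x \<in> D" for s x
  proof -
    have "occupation P slot_step (UNIV \<times> D) (s, x) \<le> ennreal C"
      using C[OF that(2) coordinator_range, of s]
      unfolding return_time_coordinator[OF that(1)] expected_return_time .
    then show ?thesis
      by (simp add: le_less_trans)
  qed
  \<comment> \<open>For an empty \<open>D\<close> the bound on the mean is vacuous, and only almost
    sure finiteness excludes it.\<close>
  have "D \<noteq> {}"
  proof
    assume "D = {}"
    interpret prob_space "mac_space M p red green"
      unfolding mac_space_def by (rule prob_space.prob_space_stream_space[OF measure_pmf.prob_space_axioms])
    have "(\<lambda>_. 0, \<lambda>_. 0) \<in> mac_states M"
      by (simp add: mac_states_def)
    from ret[OF this, of 1] M have "AE \<omega> in mac_space M p red green. False"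
      using \<open>D = {}\<close> by (simp add: return_time_def top_enat_def[symmetric])
    then show False by simp
  qed
  then obtain x0 where x0: "x0 \<in> D" by blast
  have start: "(1, x0) \<in> reachable D"
    using fin[of 1 x0] x0 D by (auto simp: reachable_def slot_states_def)
  define \<epsilon> where "\<epsilon> = (green_rate - capacity) / real M"
  have "\<epsilon> / (2 * real M) > 0"
    using green M by (simp add: \<epsilon>_def)
  moreover have "integrable P (\<lambda>u. 2 * jump_bound u)" "\<And>u. 0 \<le> 2 * jump_bound u"
    using integrable_jump_bound jump_bound_nonneg by auto
  ultimately obtain L where L: "L \<ge> 1"
    and e: "measure_pmf.expectation P (\<lambda>u. min (2 * jump_bound u) ((2 * jump_bound u)\<^sup>2 / L)) < \<epsilon> / (2 * real M)"
      (is "?e < _")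
    using small_error[where P = P and B = "\<lambda>u. 2 * jump_bound u"] by blast
  have e: "2 * real M * ?e \<le> \<epsilon>"
    using e M by (simp add: field_simps)
  \<comment> \<open>Above \<open>L\<close> no green buffer is empty, and the maximum over
    \<open>D\<close> and all coordinators makes the truncated potential vanish on
    \<open>D\<close>.\<close>
  define k where "k = Max (insert L ((\<lambda>(c, x). potential L c x) ` ({1..M} \<times> D)))"
  have k: "L \<le> k" "\<And>c x. c \<in> {1..M} \<Longrightarrow> x \<in> D \<Longrightarrow> potential L c x \<le> k"
    unfolding k_def using D(1) by (intro Max_ge; force)+
  define v where "v a = potential L (coordinator M (fst a)) (snd a)" for a
  have step: "v (slot_step u a) = potential L (coordinator M (fst a) mod M + 1) (mac_step M (coordinator M (fst a)) u (snd a))"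
    if "a \<in> slot_states" for a u
    using that by (simp add: v_def slot_step_def coordinator_Suc slot_states_def mem_Times_iff)
  have vanish: "v a \<le> k" if a: "a \<in> reachable D" for a
  proof -
    have "ennreal (max 0 (v a - k)) = 0"
    proof (rule submartingale_vanishes[where S = slot_states and P = P and F = slot_step and D = "UNIV \<times> D"
          and V = "\<lambda>a. ennreal (max 0 (v a - k))" and B = "\<lambda>u. ennreal ((3 * real M + 1) * jump_bound u)"])
      show "slot_step u a \<in> slot_states" if "a \<in> slot_states" "u \<in> set_pmf P" for a u
        using that by (rule slot_step_states)
      show zero: "ennreal (max 0 (v a - k)) = 0" if "a \<in> UNIV \<times> D" for a
      proof -
        have "v a \<le> k"
          unfolding v_def using that by (intro k(2) coordinator_range) auto
        then show ?thesis by (simp add: max_absorb1)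
      qed
      show "ennreal (max 0 (v a - k)) \<le> killed P slot_step (UNIV \<times> D) (\<lambda>a. ennreal (max 0 (v a - k))) a"
        if a: "a \<in> slot_states" for a
      proof (cases "v a \<le> k")
        case False
        let ?c = "coordinator M (fst a)"
        have pos: "snd (snd a) j > 0" if "j \<in> {1..M}" for j
          using potential_le[OF _ that, of L "snd a" ?c] False k(1) L by (force simp: v_def)
        have int: "integrable P (\<lambda>u. v (slot_step u a))"
          unfolding step[OF a] using L red by (intro integrable_potential coordinator_range) auto
        have "v a \<le> measure_pmf.expectation P (\<lambda>u. v (slot_step u a))"
          unfolding step[OF a] using potential_drift[OF coordinator_range _ _ pos, of L "fst a"] L red e
          by (simp add: v_def \<epsilon>_def)
        then have "v a - k \<le> measure_pmf.expectation P (\<lambda>u. v (slot_step u a) - k)"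
          using int by simp
        also have "\<dots> \<le> measure_pmf.expectation P (\<lambda>u. max 0 (v (slot_step u a) - k))"
          using int by (intro integral_mono) auto
        finally have "ennreal (max 0 (v a - k)) \<le> ennreal (measure_pmf.expectation P (\<lambda>u. max 0 (v (slot_step u a) - k)))"
          using False by (intro ennreal_leI) simp
        also have "\<dots> = (\<integral>\<^sup>+ u. ennreal (max 0 (v (slot_step u a) - k)) \<partial>measure_pmf P)"
          using int by (intro nn_integral_eq_integral[symmetric]) auto
        \<comment> \<open>Killing at \<open>D\<close> loses nothing, because the truncated potential
          is \<open>0\<close> there.\<close>
        also have "\<dots> = killed P slot_step (UNIV \<times> D) (\<lambda>a. ennreal (max 0 (v a - k))) a"
          unfolding killed_def using zero by (intro nn_integral_cong) auto
        finally show ?thesis .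
      qed auto
      show "ennreal (max 0 (v a - k)) \<le> ennreal (max 0 (v (slot_step u a) - k)) + ennreal ((3 * real M + 1) * jump_bound u)"
        if a: "a \<in> slot_states" for a u
      proof -
        let ?b = "(3 * real M + 1) * jump_bound u"
        have "\<bar>v (slot_step u a) - v a\<bar> \<le> ?b"
          unfolding step[OF a] unfolding v_def using L by (intro potential_jump coordinator_range) auto
        moreover have "0 \<le> ?b"
          using jump_bound_nonneg[of u] by simp
        ultimately have "ennreal (max 0 (v a - k)) \<le> ennreal (max 0 (v (slot_step u a) - k) + ?b)"
          by (intro ennreal_leI) linarith
        also have "\<dots> = ennreal (max 0 (v (slot_step u a) - k)) + ennreal ?b"
          using \<open>0 \<le> ?b\<close> by (intro ennreal_plus) auto
        finally show ?thesis .
      qed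
      have "integrable P (\<lambda>u. (3 * real M + 1) * jump_bound u)"
        using integrable_jump_bound by simp
      then show "(\<integral>\<^sup>+ u. ennreal ((3 * real M + 1) * jump_bound u) \<partial>measure_pmf P) < \<infinity>"
        using jump_bound_nonneg by (subst nn_integral_eq_integral) auto
    qed (use a in \<open>auto simp: reachable_def\<close>)
    then show ?thesis
      by (simp add: ennreal_eq_0_iff)
  qed
  \<comment> \<open>Hence \<open>green_rate > 0\<close>, so green messages do arrive and can push
    the potential above \<open>k\<close>, against \<open>vanish\<close>.\<close>
  have "0 \<le> capacity"
    using red red_rate_nonneg q_bounds M by (auto simp: capacity_def intro!: add_nonneg_nonneg mult_nonneg_nonneg)
  then obtain n where n: "n \<in> set_pmf green" "n \<ge> 1"
    using positive_green_arrivals green by (metis le_less_trans)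
  obtain s x where "(s, x) \<in> reachable D" "potential L (coordinator M s) x > k"
    using potential_unbounded[OF fin zero_red_arrivals[OF red] n start, of L k] L by auto
  then show False
    using vanish[of "(s, x)"] by (simp add: v_def)
qed

end

theorem theorem3:
  fixes M :: nat and p lambda_R lambda_G threshold :: real and red green :: "nat pmf"
  assumes "M \<ge> 1"
    and "0 < p" and "p < 1"
    and "integrable (measure_pmf red) real" and "lambda_R = measure_pmf.expectation red real"
    and "integrable (measure_pmf green) real" and "lambda_G = measure_pmf.expectation green real"
    and "lambda_R < 1"
    and "threshold =
      (if M = 1 then (1 - lambda_R) * p
       else lambda_R * (real M - 1) * p * (1 - p) ^ (M - 2)
          + (1 - lambda_R) * real M * p * (1 - p) ^ (M - 1))"
  shows "(lambda_G < threshold \<longrightarrow> mac_stable M p red green) \<and>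
         (lambda_G > threshold \<longrightarrow> \<not> mac_stable M p red green)"
proof -
  interpret mac_network M p red green
    using assms by unfold_locales
  have "threshold = capacity"
    using assms by (auto simp: capacity_def q_def q'_def red_rate_def)
  then show ?thesis
    using stable unstable assms by (simp add: red_rate_def green_rate_def)
qed

end
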